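(* Let $L\colon[a,b]\times\mathbb{R}^n\times\mathbb{R}^n\to\mathbb{R}$ be continuous and satisfy the strict convexity condition (SC) stated in the context. Let $v\in W^{1,1}((a,b);\mathbb{R}^n)$ be a minimizer of $\mathscr{L}$ over $\mathscr{A}_{v(a),v(b)}$, and let $t\in[a,b]$. (i) If $t\in(a,b]$ and $D^-v(t)$ exists and at least one of its components is infinite, then for all $m>0$, \[ \lim_{s\uparrow t}(t-s)^{-1}\lambda\big(\{r\in(s,t):\|v'(r)\|\le m\}\big)=0 . \] (ii) If $t\in[a,b)$ and $D^+v(t)$ exists and at least one of its components is infinite, then for all $m>0$, \[ \lim_{s\downarrow t}(s-t)^{-1}\lambda\big(\{r\in(t,s):\|v'(r)\|\le m\}\big)=0 . \]
   Context: $[a,b]\subseteq\mathbb{R}$, $n\ge1$, $\|\cdot\|$ is the Euclidean norm on $\mathbb{R}^n$, $\lambda$ is Lebesgue measure. Functions in $W^{1,1}((a,b);\mathbb{R}^n)$ are identified with their absolutely continuous representatives on $[a,b]$. $\mathscr{L}(u)=\int_a^bL(t,u(t),u'(t))\,dt$; $\mathscr{A}_{A,B}=\{u\in W^{1,1}((a,b);\mathbb{R}^n):u(a)=A,\ u(b)=B\}$; a minimizer of $\mathscr{L}$ over $\mathscr{A}_{v(a),v(b)}$ is $v$ with $\mathscr{L}(v)\le\mathscr{L}(u)$ for all $u\in\mathscr{A}_{v(a),v(b)}$. Condition (SC): for all $R\in[1,\infty)$ there exists $\tau_R>0$ such that for all $(t,y,p)\in[a,b]\times\mathbb{R}^n\times\mathbb{R}^n$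 with $\max\{|t|,\|y\|,\|p\|\}\le R+1$ there exists a subdifferential (subgradient) $\xi\in\mathbb{R}^n$ of $L(t,y,\cdot)$ at $p$ (i.e. $L(t,y,q)\ge L(t,y,p)+\xi\cdot(q-p)$ for all $q\in\mathbb{R}^n$) such that $L(t,y,q)\ge L(t,y,p)+\xi\cdot(q-p)+2\tau_R$ whenever $\|q-p\|\ge R^{-1}$. One-sided derivatives: for scalar $v$, $D^-v(t)=\lim_{s\uparrow t}\frac{v(s)-v(t)}{s-t}$ and $D^+v(t)=\lim_{s\downarrow t}\frac{v(s)-v(t)}{s-t}$, whenever these limits make sense and exist as finite or infinite values; for vector-valued $v$ they are formed componentwise and exist iff they exist (as finite or infinite values) for each component. *)

theory Defs
  imports "HOL-Analysis.Analysis"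
begin

definition absolutely_continuous_on_Icc :: "real \<Rightarrow> real \<Rightarrow> (real \<Rightarrow> real ^ 'n) \<Rightarrow> bool"
  where "absolutely_continuous_on_Icc a b u \<longleftrightarrow>
    (\<forall>\<epsilon>>0. \<exists>\<delta>>0. \<forall>(k::nat) (c :: nat \<Rightarrow> real) (d :: nat \<Rightarrow> real).
       (\<forall>i<k. a \<le> c i \<and> c i \<le> d i \<and> d i \<le> b) \<and>
       disjoint_family_on (\<lambda>i. {c i<..<d i}) {..<k} \<and>
       (\<Sum>i<k. d i - c i) < \<delta> \<longrightarrow>
       (\<Sum>i<k. norm (u (d i) - u (c i))) < \<epsilon>)"

text \<open>Smooth functions with compact support in the open interval from \<open>a\<close> to \<open>b\<close>;
  the support is bounded, so its being closed already makes it compact.\<close>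

definition test_function :: "real \<Rightarrow> real \<Rightarrow> (real \<Rightarrow> real) \<Rightarrow> bool"
  where "test_function a b \<phi> \<longleftrightarrow>
    (\<forall>k x. ((deriv ^^ k) \<phi>) differentiable (at x)) \<and>
    closure {x. \<phi> x \<noteq> 0} \<subseteq> {a<..<b}"

definition has_weak_derivative ::
    "real \<Rightarrow> real \<Rightarrow> (real \<Rightarrow> real ^ 'n) \<Rightarrow> (real \<Rightarrow> real ^ 'n) \<Rightarrow> bool"
  where "has_weak_derivative a b u g \<longleftrightarrow>
    set_integrable lebesgue {a<..<b} u \<and> set_integrable lebesgue {a<..<b} g \<and>
    (\<forall>\<phi>. test_function a b \<phi> \<longrightarrow>
      (LINT t:{a<..<b}|lebesgue. deriv \<phi> t *\<^sub>R u t) = - (LINT t:{a<..<b}|lebesgue. \<phi> t *\<^sub>R g t))"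

text \<open>The elements of $W^{1,1}((a,b);\mathbb{R}^n)$, as absolutely continuous representatives.
  Only the values on \<open>{a..b}\<close> matter; those elsewhere are unconstrained.\<close>

definition W11 :: "real \<Rightarrow> real \<Rightarrow> (real \<Rightarrow> real ^ 'n) set"
  where "W11 a b = {u. absolutely_continuous_on_Icc a b u \<and> (\<exists>g. has_weak_derivative a b u g)}"

text \<open>A representative of the derivative \<open>u'\<close>. It is determined only up to null sets,
  and everything below depends only on its almost-everywhere class.\<close>

definition weak_deriv :: "real \<Rightarrow> real \<Rightarrow> (real \<Rightarrow> real ^ 'n) \<Rightarrow> real \<Rightarrow> real ^ 'n"
  where "weak_deriv a b u = (SOME g. has_weak_derivative a b u g)"

definition W11_bc :: "real \<Rightarrow> real \<Rightarrow> real ^ 'n \<Rightarrow> real ^ 'n \<Rightarrow> (real \<Rightarrow> real ^ 'n) set"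
  where "W11_bc a b A B = {u \<in> W11 a b. u a = A \<and> u b = B}"

text \<open>The integral of \<open>L t (u t) (u' t)\<close> need not be finite, so it is extended-real-valued: the
  integral of the positive part minus that of the negative part (\<open>ennreal\<close> sends negative
  reals to 0). For \<open>u\<close> in \<^term>\<open>W11 a b\<close> and \<open>L\<close> continuous and convex in its last argument the
  negative part has finite integral, because \<open>L\<close> is bounded below by an affine function of
  the norm of \<open>u'\<close> along \<open>u\<close>; hence the difference is never of the form \<open>\<infinity> - \<infinity>\<close>.\<close>

definition action ::
    "(real \<Rightarrow> real ^ 'n \<Rightarrow> real ^ 'n \<Rightarrow> real) \<Rightarrow> real \<Rightarrow> real \<Rightarrow> (real \<Rightarrow> real ^ 'n) \<Rightarrow> ereal"
  where "action L a b u =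
    enn2ereal (\<integral>\<^sup>+t\<in>{a<..<b}. ennreal (L t (u t) (weak_deriv a b u t)) \<partial>lebesgue) -
    enn2ereal (\<integral>\<^sup>+t\<in>{a<..<b}. ennreal (- L t (u t) (weak_deriv a b u t)) \<partial>lebesgue)"

definition is_minimizer ::
    "(real \<Rightarrow> real ^ 'n \<Rightarrow> real ^ 'n \<Rightarrow> real) \<Rightarrow> real \<Rightarrow> real \<Rightarrow> (real \<Rightarrow> real ^ 'n) \<Rightarrow> bool"
  where "is_minimizer L a b v \<longleftrightarrow>
    v \<in> W11_bc a b (v a) (v b) \<and> (\<forall>u \<in> W11_bc a b (v a) (v b). action L a b v \<le> action L a b u)"

definition is_subgradient :: "(real ^ 'n \<Rightarrow> real) \<Rightarrow> real ^ 'n \<Rightarrow> real ^ 'n \<Rightarrow> bool"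
  where "is_subgradient f p \<xi> \<longleftrightarrow> (\<forall>q. f q \<ge> f p + \<xi> \<bullet> (q - p))"

definition strict_convexity_SC ::
    "real \<Rightarrow> real \<Rightarrow> (real \<Rightarrow> real ^ 'n \<Rightarrow> real ^ 'n \<Rightarrow> real) \<Rightarrow> bool"
  where "strict_convexity_SC a b L \<longleftrightarrow>
    (\<forall>R\<ge>1. \<exists>\<tau>>0. \<forall>t\<in>{a..b}. \<forall>y p. Max {\<bar>t\<bar>, norm y, norm p} \<le> R + 1 \<longrightarrow>
       (\<exists>\<xi>. is_subgradient (L t y) p \<xi> \<and>
            (\<forall>q. norm (q - p) \<ge> inverse R \<longrightarrow> L t y q \<ge> L t y p + \<xi> \<bullet> (q - p) + 2 * \<tau>)))"

text \<open>One-sided derivatives are componentwise limits in the extended reals: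
  \<open>F = at_left t\<close> gives $D^-v(t)$ and \<open>F = at_right t\<close> gives $D^+v(t)$.\<close>

definition has_extended_derivative ::
    "(real \<Rightarrow> real ^ 'n) \<Rightarrow> real \<Rightarrow> ereal ^ 'n \<Rightarrow> real filter \<Rightarrow> bool"
  where "has_extended_derivative v t D F \<longleftrightarrow>
    (\<forall>i. ((\<lambda>s. ereal ((v s $ i - v t $ i) / (s - t))) \<longlongrightarrow> D $ i) F)"

end

theory Submission
  imports Defs
begin

text \<open>An infinite one-sided derivative of \<open>v\<close> at \<open>t\<close> enters only through its consequence that
\<open>norm (v s - v t) / \<bar>s - t\<bar>\<close> tends to infinity. Fix \<open>m\<close>, call the set where \<open>norm v' \<le> m\<close> slow,
and put \<open>M = m + 1\<close>. Two facts, one from the calculus of variations and one from the geometry of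
the line, then show that the slow set has density 0 at \<open>t\<close>.

First, the slow set is sparse under every chord of slope \<open>M\<close> close to \<open>t\<close>
(\<open>slow_set_sparse\<close>): if \<open>norm (v y - v x) = M * (y - x)\<close>, compare \<open>v\<close> with the function that
follows the chord on \<open>{x..y}\<close>. By (SC) the Lagrangian lies above its supporting affine
function at the chord slope \<open>p\<close>, and by a definite amount \<open>\<tau>\<close> at velocities at distance at least 1
from \<open>p\<close>; every slow velocity is such, as \<open>norm p = M\<close>. The affine part
integrates to the same value for \<open>v\<close> and for the chord, and the variation of \<open>L\<close> in the first two
arguments costs at most a small \<open>\<epsilon>\<close> per unit of length, so minimality gives
\<open>\<tau> * \<bar>slow set\<bar> \<le> 2 * \<epsilon> * (y - x)\<close>. Continuity of \<open>L\<close> gives no uniform control at large velocities. This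
is why the slope of the competitor has to be bounded: the comparison uses continuity only at velocities of
norm at most \<open>M + 1\<close>, and convexity carries the lower bound from there to all velocities
(\<open>uniform_strict_support\<close>).

Second, chords of slope \<open>M\<close> cover the slow set near \<open>t\<close>, up to an arbitrarily small part, with total length
at most twice that of the interval (\<open>sublevel_measure_bound\<close>). Wherever \<open>v\<close> is slow on a short interval, the chord across it has slope
less than \<open>M\<close>, while the chord to \<open>t\<close> has slope greater than \<open>M\<close>; by the intermediate value theorem
one can go back towards \<open>t\<close> until the slope is exactly \<open>M\<close>. Hence the slow set near \<open>t\<close> has
density at most twice the density under the chords, which is arbitrarily small.

The rest provides the calculus in $W^{1,1}$ that the comparison needs: the elements of $W^{1,1}$ are the
primitives of integrable functions (\<open>W11_primitive_on\<close>, \<open>primitive_on_W11\<close>), so that the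
competitor is admissible and its weak derivative is the expected one.\<close>

section \<open>Smooth step functions\<close>

text \<open>The powers of \<open>1 / s\<close> are part of the definition because differentiating
\<open>exp (- 1 / s)\<close> produces them; their span is closed under differentiation.\<close>

definition flat_exp :: "nat \<Rightarrow> real \<Rightarrow> real"
  where "flat_exp k s = (if s > 0 then inverse s ^ k * exp (- inverse s) else 0)"

lemma flat_exp_quotient_tendsto_0:
  "((\<lambda>s. flat_exp k s / s) \<longlongrightarrow> 0) (at 0)"
proof -
  \<comment> \<open>with \<open>z = 1 / s\<close>\<close>
  have "((\<lambda>z::real. z ^ Suc k / exp z) \<longlongrightarrow> 0) at_top"
    by (rule tendsto_power_div_exp_0)
  then have "((\<lambda>s::real. inverse s ^ Suc k / exp (inverse s)) \<longlongrightarrow> 0) (at_right 0)"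
    by (rule filterlim_compose) (rule filterlim_inverse_at_top_right)
  moreover have "\<forall>\<^sub>F s in at_right 0. inverse s ^ Suc k / exp (inverse s) = flat_exp k s / (s::real)"
    unfolding eventually_at_right_field
    by (auto simp: flat_exp_def exp_minus field_simps intro!: exI[of _ 1])
  ultimately have "((\<lambda>s. flat_exp k s / s) \<longlongrightarrow> 0) (at_right 0)"
    by (rule Lim_transform_eventually)
  moreover have "((\<lambda>s. flat_exp k s / s) \<longlongrightarrow> 0) (at_left 0)"
    by (rule tendsto_eventually) (auto simp: flat_exp_def eventually_at_left_field intro!: exI[of _ "-1"])
  ultimately show ?thesis
    by (simp add: filterlim_at_split)
qed

lemma flat_exp_has_derivative:
  "(flat_exp k has_real_derivative (flat_exp (k + 2) x - real k * flat_exp (k + 1) x)) (at x)"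
proof -
  consider "x > 0" | "x < 0" | "x = 0" by linarith
  then show ?thesis
  proof cases
    case 1
    have "((\<lambda>s. inverse s ^ k * exp (- inverse s)) has_real_derivative
        (flat_exp (k + 2) x - real k * flat_exp (k + 1) x)) (at x)"
      using 1
      by (cases k; auto intro!: derivative_eq_intros DERIV_power simp del: power_Suc)
        (auto simp: flat_exp_def field_simps power2_eq_square)
    then show ?thesis
      by (rule has_field_derivative_transform_within[where d = x])
        (use 1 in \<open>auto simp: flat_exp_def dist_real_def\<close>)
  next
    case 2
    have "((\<lambda>s. 0) has_real_derivative (flat_exp (k + 2) x - real k * flat_exp (k + 1) x)) (at x)"
      using 2 by (simp add: flat_exp_def)
    then show ?thesis
      by (rule has_field_derivative_transform_within[where d = "-x"])
        (use 2 in \<open>auto simp: flat_exp_def dist_real_def\<close>)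
  next
    case 3
    then show ?thesis
      using flat_exp_quotient_tendsto_0[of k]
      by (simp add: flat_exp_def has_field_derivative_iff)
  qed
qed

text \<open>Every member has its derivative in the algebra again, so membership yields smoothness without
computing any higher derivative. Antiderivatives are included so that a step function can be
obtained by integrating a nonnegative bump, which makes its monotonicity evident.\<close>

inductive_set bump_algebra :: "(real \<Rightarrow> real) set" where
  flat: "flat_exp k \<in> bump_algebra"
| const: "(\<lambda>_. c) \<in> bump_algebra"
| add: "f \<in> bump_algebra \<Longrightarrow> g \<in> bump_algebra \<Longrightarrow> (\<lambda>x. f x + g x) \<in> bump_algebra"
| mult: "f \<in> bump_algebra \<Longrightarrow> g \<in> bump_algebra \<Longrightarrow> (\<lambda>x. f x * g x) \<in> bump_algebra"
| affine: "f \<in> bump_algebra \<Longrightarrow> (\<lambda>x. f (\<alpha> * x + \<beta>)) \<in> bump_algebra"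
| antideriv: "f \<in> bump_algebra \<Longrightarrow> (\<And>x. (F has_real_derivative f x) (at x)) \<Longrightarrow> F \<in> bump_algebra"

lemma bump_algebra_has_derivative:
  assumes "f \<in> bump_algebra"
  shows "\<exists>f'\<in>bump_algebra. \<forall>x. (f has_real_derivative f' x) (at x)"
  using assms
proof (induction rule: bump_algebra.induct)
  case (flat k)
  have "(\<lambda>x. flat_exp (k + 2) x + (\<lambda>_. - real k) x * flat_exp (k + 1) x) \<in> bump_algebra"
    by (intro bump_algebra.add bump_algebra.mult bump_algebra.flat bump_algebra.const)
  then show ?case
    using flat_exp_has_derivative[of k]
    by (intro bexI[of _ "\<lambda>x. flat_exp (k + 2) x + (\<lambda>_. - real k) x * flat_exp (k + 1) x"]) auto
next
  case (const c)
  show ?case by (rule bexI[of _ "\<lambda>_. 0"]) (auto intro: bump_algebra.const)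
next
  case (add f g)
  from add.IH obtain f' g' where *: "f' \<in> bump_algebra" "g' \<in> bump_algebra"
    "\<And>x. (f has_real_derivative f' x) (at x)" "\<And>x. (g has_real_derivative g' x) (at x)" by blast
  show ?case
  proof (intro bexI allI)
    show "((\<lambda>x. f x + g x) has_real_derivative f' x + g' x) (at x)" for x
      by (rule DERIV_add[OF *(3,4)])
    show "(\<lambda>x. f' x + g' x) \<in> bump_algebra"
      by (rule bump_algebra.add[OF *(1,2)])
  qed
next
  case (mult f g)
  from mult.IH obtain f' g' where *: "f' \<in> bump_algebra" "g' \<in> bump_algebra"
    "\<And>x. (f has_real_derivative f' x) (at x)" "\<And>x. (g has_real_derivative g' x) (at x)" by blast
  show ?case
  proof (intro bexI allI)
    show "((\<lambda>x. f x * g x) has_real_derivative f' x * g x + g' x * f x) (at x)" for x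
      by (rule DERIV_mult[OF *(3,4)])
    show "(\<lambda>x. f' x * g x + g' x * f x) \<in> bump_algebra"
      by (intro bump_algebra.add bump_algebra.mult * mult.hyps)
  qed
next
  case (affine f \<alpha> \<beta>)
  from affine.IH obtain f' where *: "f' \<in> bump_algebra" "\<And>x. (f has_real_derivative f' x) (at x)" by blast
  show ?case
  proof (intro bexI allI)
    show "((\<lambda>x. f (\<alpha> * x + \<beta>)) has_real_derivative f' (\<alpha> * x + \<beta>) * (\<lambda>_. \<alpha>) x) (at x)" for x
      by (rule DERIV_chain2[OF *(2)]) (auto intro!: derivative_eq_intros)
    show "(\<lambda>x. f' (\<alpha> * x + \<beta>) * (\<lambda>_. \<alpha>) x) \<in> bump_algebra"
      by (rule bump_algebra.mult[OF bump_algebra.affine[OF *(1)] bump_algebra.const])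
  qed
next
  case (antideriv f F)
  show ?case by (intro bexI[OF _ antideriv.hyps(1)] allI antideriv.hyps(2))
qed

lemma bump_algebra_smooth:
  assumes "f \<in> bump_algebra"
  shows "((deriv ^^ k) f) differentiable (at x)"
proof -
  have "(deriv ^^ k) f \<in> bump_algebra"
  proof (induction k)
    case (Suc k)
    obtain h' where h': "h' \<in> bump_algebra" "\<And>x. ((deriv ^^ k) f has_real_derivative h' x) (at x)"
      using bump_algebra_has_derivative[OF Suc] by blast
    then have "deriv ((deriv ^^ k) f) = h'" by (auto intro: DERIV_imp_deriv)
    with h' show ?case by simp
  qed (use assms in simp)
  from bump_algebra_has_derivative[OF this] show ?thesis
    by (auto simp: real_differentiable_def)
qed

text \<open>The step is the normalised antiderivative of the bump \<open>exp (- 1 / (1 + x)) * exp (- 1 / (1 - x))\<close>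
on \<open>{-1<..<1}\<close>. Differences of two rescaled steps serve as test functions that approximate the
indicator function of an interval, with derivatives that approximate point masses at its ends.\<close>

lemma smooth_step_exists:
  "\<exists>S S'. S \<in> bump_algebra \<and> (\<forall>x. (S has_real_derivative S' x) (at x)) \<and> continuous_on UNIV S' \<and>
     (\<forall>x. S' x \<ge> 0) \<and> (\<forall>x. x \<le> -1 \<longrightarrow> S x = 0) \<and> (\<forall>x. x \<ge> 1 \<longrightarrow> S x = 1) \<and>
     (\<forall>x. \<bar>x\<bar> \<ge> 1 \<longrightarrow> S' x = 0)"
proof -
  define \<psi> where "\<psi> x = flat_exp 0 (1 * x + 1) * flat_exp 0 (-1 * x + 1)" for x
  have \<psi>_alg: "\<psi> \<in> bump_algebra"
    unfolding \<psi>_def by (intro bump_algebra.mult bump_algebra.affine bump_algebra.flat)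
  obtain \<psi>' where "\<And>x. (\<psi> has_real_derivative \<psi>' x) (at x)"
    using bump_algebra_has_derivative[OF \<psi>_alg] by metis
  then have cont: "continuous_on A \<psi>" for A
    by (intro continuous_at_imp_continuous_on ballI DERIV_isCont)
  have nonneg: "\<psi> x \<ge> 0" for x by (simp add: \<psi>_def flat_exp_def)
  have outside: "\<psi> x = 0" if "\<bar>x\<bar> \<ge> 1" for x using that by (auto simp: \<psi>_def flat_exp_def)
  \<comment> \<open>any lower limit to the left of the support would do; it only has to stay away from \<open>-1\<close>, where two formulas for \<open>F\<close> meet\<close>
  define F where "F x = integral {-3..x} \<psi>" for x
  have F_left: "F x = 0" if "x \<le> -1" for x
    unfolding F_def using that outside by (intro integral_unique has_integral_is_0) auto
  have F_deriv: "(F has_real_derivative \<psi> x) (at x)" for x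
  proof (cases "x < -1")
    case True
    have "((\<lambda>_. 0) has_real_derivative \<psi> x) (at x)" using True outside by simp
    then show ?thesis
      by (rule has_field_derivative_transform_within[where d = "-1 - x"])
        (use True F_left in \<open>auto simp: dist_real_def\<close>)
  next
    case False
    have "(F has_real_derivative \<psi> x) (at x within {-3..x+1})"
      unfolding F_def by (rule integral_has_real_derivative[OF cont]) (use False in auto)
    then show ?thesis
      using False by (subst (asm) at_within_Icc_at) auto
  qed
  have F_right: "F x = F 1" if "x \<ge> 1" for x
  proof -
    have "(\<psi> has_integral (F x - F 1)) {1..x}"
      by (rule fundamental_theorem_of_calculus)
        (simp_all add: that has_field_derivative_at_within[OF F_deriv]
           flip: has_real_derivative_iff_has_vector_derivative)
    moreover have "(\<psi> has_integral 0) {1..x}"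
      using outside by (intro has_integral_is_0) auto
    ultimately have "F x - F 1 = 0" by (rule has_integral_unique)
    then show ?thesis by simp
  qed
  have "F 1 > 0"
  proof -
    have "F (-1) \<le> F 0"
      by (rule DERIV_nonneg_imp_nondecreasing[of _ _ F]) (use F_deriv nonneg in auto)
    moreover have "F 0 < F 1"
    proof (rule DERIV_pos_imp_increasing_open[of 0 1 F])
      show "\<exists>y. (F has_real_derivative y) (at x) \<and> 0 < y" if "0 < x" "x < 1" for x
        by (intro exI[of _ "\<psi> x"] conjI F_deriv) (use that in \<open>simp add: \<psi>_def flat_exp_def\<close>)
      show "continuous_on {0..1} F"
        by (intro continuous_at_imp_continuous_on ballI DERIV_isCont[OF F_deriv])
    qed simp
    ultimately show ?thesis using F_left[of "-1"] by simp
  qed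
  have "F \<in> bump_algebra" by (rule bump_algebra.antideriv[OF \<psi>_alg F_deriv])
  then have alg: "(\<lambda>x. F x * (\<lambda>_. 1 / F 1) x) \<in> bump_algebra"
    by (intro bump_algebra.mult bump_algebra.const)
  have deriv: "((\<lambda>x. F x * (\<lambda>_. 1 / F 1) x) has_real_derivative \<psi> x * (1 / F 1)) (at x)" for x
    by (rule DERIV_cmult_right[OF F_deriv])
  show ?thesis
  proof (intro exI conjI allI impI)
    show "(\<lambda>x. F x * (\<lambda>_. 1 / F 1) x) \<in> bump_algebra" by (rule alg)
    show "((\<lambda>x. F x * (\<lambda>_. 1 / F 1) x) has_real_derivative \<psi> x * (1 / F 1)) (at x)" for x
      by (rule deriv)
    show "continuous_on UNIV (\<lambda>x. \<psi> x * (1 / F 1))"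
      by (intro continuous_intros cont)
    show "F x * (1 / F 1) = 1" if "x \<ge> 1" for x
      using \<open>F 1 > 0\<close> by (simp add: F_right[OF that])
  qed (use \<open>F 1 > 0\<close> in \<open>simp_all add: nonneg outside F_left\<close>)
qed

section \<open>Primitives of integrable functions\<close>

definition truncate :: "real \<Rightarrow> 'b::real_normed_vector \<Rightarrow> 'b"
  where "truncate K z = (K / max K (norm z)) *\<^sub>R z"

lemma norm_truncate_le: "0 < K \<Longrightarrow> norm (truncate K z) \<le> K"
  by (auto simp: truncate_def field_simps max_def)

lemma norm_diff_truncate_le:
  assumes "0 < K"
  shows "norm (z - truncate K z) \<le> norm z"
proof -
  have "z - truncate K z = (1 - K / max K (norm z)) *\<^sub>R z"
    by (simp add: truncate_def scaleR_left_diff_distrib)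
  moreover have "0 \<le> K / max K (norm z)" "K / max K (norm z) \<le> 1"
    using assms by (auto simp: max_def divide_le_eq_1)
  ultimately show ?thesis
    by (simp add: mult_left_le_one_le)
qed

lemma truncate_id: "0 < K \<Longrightarrow> norm z \<le> K \<Longrightarrow> truncate K z = z"
  by (simp add: truncate_def max_def)

lemma continuous_on_truncate: "0 < K \<Longrightarrow> continuous_on A (truncate K)"
  unfolding truncate_def by (intro continuous_intros) auto

text \<open>A measurable function is almost everywhere the limit of continuous ones, but without a common
integrable bound. Truncation supplies the bound: it changes \<open>f\<close> little in \<open>L\<^sup>1\<close> at a high level \<open>K\<close>, and at
that fixed level dominated convergence applies to the truncated approximants.\<close>

lemma L1_approx_continuous:
  fixes f :: "real \<Rightarrow> 'b::euclidean_space"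
  assumes f: "f absolutely_integrable_on {p..q}" and "0 < e"
  obtains k where "continuous_on UNIV k" "integral {p..q} (\<lambda>x. norm (f x - k x)) < e"
proof -
  define M where "M = lebesgue_on {p..q}"
  have int_f: "integrable M f"
    unfolding M_def by (rule absolutely_integrable_imp_integrable[OF f]) simp
  then have f_meas: "f \<in> borel_measurable M" by auto
  have space_M: "space M = {p..q}" by (simp add: M_def)
  have M_fin: "integrable M (\<lambda>_. c::real)" for c
    unfolding M_def by (intro absolutely_integrable_imp_integrable) auto
  have trunc_meas: "truncate K \<in> borel_measurable borel" if "0 < K" for K :: real
    using continuous_on_truncate[OF that] by (rule borel_measurable_continuous_onI)
  have tf_meas: "(\<lambda>x. truncate K (f x)) \<in> borel_measurable M" if "0 < K" for K
    using measurable_compose[OF f_meas trunc_meas[OF that]] .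
  have "(\<lambda>n. \<integral>x. norm (f x - truncate (real (Suc n)) (f x)) \<partial>M) \<longlonglongrightarrow> (\<integral>x. 0 \<partial>M)"
  proof (rule integral_dominated_convergence[where w = "\<lambda>x. norm (f x)"])
    show "AE x in M. (\<lambda>n. norm (f x - truncate (real (Suc n)) (f x))) \<longlonglongrightarrow> 0"
    proof (intro AE_I2 tendsto_eventually)
      fix x
      obtain N where "norm (f x) \<le> real N" using real_arch_simple by blast
      then have "norm (f x) \<le> real (Suc n)" if "n \<ge> N" for n using that by simp
      then show "\<forall>\<^sub>F n in sequentially. norm (f x - truncate (real (Suc n)) (f x)) = 0"
        by (auto intro!: eventually_sequentiallyI[of N] simp: truncate_id simp del: of_nat_Suc)
    qed
    show "(\<lambda>x. norm (f x - truncate (real (Suc n)) (f x))) \<in> borel_measurable M" for n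
      using f_meas tf_meas[of "real (Suc n)", OF of_nat_0_less_iff[THEN iffD2, OF zero_less_Suc]] by measurable
    show "AE x in M. norm (norm (f x - truncate (real (Suc n)) (f x))) \<le> norm (f x)" for n
      by (simp add: norm_diff_truncate_le)
  qed (use int_f in auto)
  then have "\<forall>\<^sub>F n in sequentially. (\<integral>x. norm (f x - truncate (real (Suc n)) (f x)) \<partial>M) < e / 2"
    using \<open>0 < e\<close> by (intro order_tendstoD) auto
  then obtain n0 where n0: "(\<integral>x. norm (f x - truncate (real (Suc n0)) (f x)) \<partial>M) < e / 2"
    by (auto simp: eventually_sequentially)
  define K where "K = real (Suc n0)"
  have "0 < K" by (simp add: K_def)
  have "f measurable_on {p..q}"
    using f_meas by (simp add: M_def measurable_on_iff_borel_measurable)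
  then obtain N F where N: "negligible N" and F: "\<And>n. continuous_on UNIV (F n)"
    and lim: "\<And>x. x \<notin> N \<Longrightarrow> (\<lambda>n. F n x) \<longlonglongrightarrow> (if x \<in> {p..q} then f x else 0)"
    unfolding measurable_on_def by blast
  have tF_cont: "continuous_on UNIV (\<lambda>x. truncate K (F n x))" for n
    by (rule continuous_on_compose2[OF continuous_on_truncate[OF \<open>0 < K\<close>] F]) auto
  have tF_meas: "(\<lambda>x. truncate K (F n x)) \<in> borel_measurable M" for n
    unfolding M_def by (rule continuous_imp_measurable_on_sets_lebesgue[OF continuous_on_subset[OF tF_cont]]) auto
  have "(\<lambda>n. \<integral>x. norm (truncate K (f x) - truncate K (F n x)) \<partial>M) \<longlonglongrightarrow> (\<integral>x. 0 \<partial>M)"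
  proof (rule integral_dominated_convergence[where w = "\<lambda>x. 2 * K"])
    have "AE x in lebesgue. x \<notin> N"
      using N by (intro AE_not_in) (simp add: negligible_iff_null_sets)
    then have "AE x in M. x \<notin> N"
      unfolding M_def by (subst AE_restrict_space_iff) auto
    then show "AE x in M. (\<lambda>n. norm (truncate K (f x) - truncate K (F n x))) \<longlonglongrightarrow> 0"
      using AE_space
    proof eventually_elim
      case (elim x)
      then have "(\<lambda>n. F n x) \<longlonglongrightarrow> f x" using lim[of x] by (simp add: space_M)
      then have "(\<lambda>n. truncate K (F n x)) \<longlonglongrightarrow> truncate K (f x)"
        using continuous_on_truncate[OF \<open>0 < K\<close>, of "UNIV :: 'b set"]
        by (intro isCont_tendsto_compose[of "f x" "truncate K"]) (simp_all add: continuous_on_eq_continuous_at)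
      then have "(\<lambda>n. truncate K (f x) - truncate K (F n x)) \<longlonglongrightarrow> truncate K (f x) - truncate K (f x)"
        by (intro tendsto_intros)
      then show ?case by (simp add: tendsto_norm_zero)
    qed
    show "(\<lambda>x. norm (truncate K (f x) - truncate K (F n x))) \<in> borel_measurable M" for n
      using tf_meas[OF \<open>0 < K\<close>] tF_meas[of n] by measurable
    show "AE x in M. norm (norm (truncate K (f x) - truncate K (F n x))) \<le> 2 * K" for n
    proof (rule AE_I2)
      show "norm (norm (truncate K (f x) - truncate K (F n x))) \<le> 2 * K" for x
        using norm_triangle_ineq4[of "truncate K (f x)" "truncate K (F n x)"]
          norm_truncate_le[OF \<open>0 < K\<close>, of "f x"] norm_truncate_le[OF \<open>0 < K\<close>, of "F n x"] by simp
    qed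
  qed (use M_fin in auto)
  then have "\<forall>\<^sub>F n in sequentially. (\<integral>x. norm (truncate K (f x) - truncate K (F n x)) \<partial>M) < e / 2"
    using \<open>0 < e\<close> by (intro order_tendstoD) auto
  then obtain n1 where n1: "(\<integral>x. norm (truncate K (f x) - truncate K (F n1 x)) \<partial>M) < e / 2"
    by (auto simp: eventually_sequentially)
  define k where "k x = truncate K (F n1 x)" for x
  have int_tf: "integrable M (\<lambda>x. truncate K (f x))"
    by (rule Bochner_Integration.integrable_bound[OF M_fin[of K] tf_meas[OF \<open>0 < K\<close>]])
      (use norm_truncate_le[OF \<open>0 < K\<close>] \<open>0 < K\<close> in auto)
  have int_k: "integrable M k"
    unfolding k_def by (rule Bochner_Integration.integrable_bound[OF M_fin[of K] tF_meas])
      (use norm_truncate_le[OF \<open>0 < K\<close>] \<open>0 < K\<close> in auto)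
  have "(\<integral>x. norm (f x - k x) \<partial>M) \<le>
      (\<integral>x. norm (f x - truncate K (f x)) + norm (truncate K (f x) - k x) \<partial>M)"
  proof (rule integral_mono)
    show "norm (f x - k x) \<le> norm (f x - truncate K (f x)) + norm (truncate K (f x) - k x)" for x
      using norm_triangle_ineq[of "f x - truncate K (f x)" "truncate K (f x) - k x"] by simp
  qed (use int_f int_tf int_k in auto)
  also have "\<dots> < e"
    using n0[folded K_def] n1[folded k_def] int_f int_tf int_k
    by (subst Bochner_Integration.integral_add) auto
  finally have "(\<integral>x. norm (f x - k x) \<partial>M) < e" .
  moreover have "(\<integral>x. norm (f x - k x) \<partial>M) = integral {p..q} (\<lambda>x. norm (f x - k x))"
    using int_f int_k unfolding M_def by (intro lebesgue_integral_eq_integral) auto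
  moreover have "continuous_on UNIV k"
    unfolding k_def by (rule tF_cont)
  ultimately show ?thesis using that by simp
qed

text \<open>The concrete form of $W^{1,1}$: \<open>u\<close> is the indefinite integral of the integrable function \<open>g\<close>.
Stating it for all subintervals lets primitives be restricted and glued.\<close>

definition primitive_on :: "real \<Rightarrow> real \<Rightarrow> (real \<Rightarrow> 'b::euclidean_space) \<Rightarrow> (real \<Rightarrow> 'b) \<Rightarrow> bool"
  where "primitive_on a b u g \<longleftrightarrow> g absolutely_integrable_on {a..b} \<and>
    (\<forall>c d. a \<le> c \<longrightarrow> c \<le> d \<longrightarrow> d \<le> b \<longrightarrow> (g has_integral (u d - u c)) {c..d})"

lemma primitive_onD:
  "primitive_on a b u g \<Longrightarrow> a \<le> c \<Longrightarrow> c \<le> d \<Longrightarrow> d \<le> b \<Longrightarrow> (g has_integral (u d - u c)) {c..d}"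
  by (simp add: primitive_on_def)

lemma primitive_on_integrable:
  assumes "primitive_on a b u g" "{c..d} \<subseteq> {a..b}"
  shows "g absolutely_integrable_on {c..d}"
  using assms unfolding primitive_on_def by (meson set_integrable_subset lmeasurable_iff_integrable
      fmeasurableD lmeasurable_cbox lmeasurable_interval(1))

lemma primitive_onI:
  assumes g: "g absolutely_integrable_on {a..b}"
    and u: "\<And>r. a \<le> r \<Longrightarrow> r \<le> b \<Longrightarrow> (g has_integral (u r - u a)) {a..r}"
  shows "primitive_on a b u g"
  unfolding primitive_on_def
proof (intro conjI g allI impI)
  fix c d assume cd: "a \<le> c" "c \<le> d" "d \<le> b"
  have "g integrable_on {c..d}"
    using set_lebesgue_integral_eq_integral(1)[OF g] cd by (auto intro: integrable_on_subinterval)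
  moreover have "integral {a..c} g + integral {c..d} g = integral {a..d} g"
    using u[of d] cd by (intro Henstock_Kurzweil_Integration.integral_combine) auto
  ultimately show "(g has_integral (u d - u c)) {c..d}"
    using u[of d] u[of c] cd by (simp add: has_integral_iff algebra_simps) (metis add.assoc)
qed

lemma negligible_Icc_overlap:
  fixes c d c' d' :: real
  assumes "{c<..<d} \<inter> {c'<..<d'} = {}" "c \<le> d" "c' \<le> d'"
  shows "negligible ({c..d} \<inter> {c'..d'})"
proof -
  have "{c..d} \<inter> {c'..d'} \<subseteq> {c, d, c', d'} \<union> ({c<..<d} \<inter> {c'<..<d'})" by auto
  with assms show ?thesis
    by (auto intro: negligible_subset[OF negligible_finite[of "{c,d,c',d'}"]])
qed

text \<open>Split \<open>g\<close> into a continuous, hence bounded, part and a remainder that is small in \<open>L\<^sup>1\<close>.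
On disjoint intervals the remainder contributes little however long they are, and the bounded part contributes
little once their total length is small.\<close>

lemma primitive_on_absolutely_continuous:
  assumes prim: "primitive_on a b u g"
  shows "absolutely_continuous_on_Icc a b u"
  unfolding absolutely_continuous_on_Icc_def
proof (intro allI impI)
  fix e :: real assume "0 < e"
  have g: "g absolutely_integrable_on {a..b}" using prim by (simp add: primitive_on_def)
  obtain k where k: "continuous_on UNIV k" "integral {a..b} (\<lambda>x. norm (g x - k x)) < e / 2"
    using L1_approx_continuous[OF g, of "e / 2"] \<open>0 < e\<close> by auto
  have "bounded (k ` {a..b})"
    using k(1) by (intro compact_imp_bounded compact_continuous_image continuous_on_subset[OF k(1)]) auto
  then obtain B where B: "0 < B" "\<And>x. x \<in> {a..b} \<Longrightarrow> norm (k x) \<le> B"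
    unfolding bounded_pos by auto
  define h where "h x = norm (g x - k x)" for x
  have "(\<lambda>x. g x - k x) absolutely_integrable_on {a..b}"
    by (intro set_integral_diff(1)[OF g] absolutely_integrable_continuous_real continuous_on_subset[OF k(1)]) auto
  then have h_int: "h integrable_on {a..b}"
    unfolding h_def absolutely_integrable_on_def by simp
  have h_sub: "h integrable_on {c..d}" if "a \<le> c" "d \<le> b" for c d
    using h_int by (rule integrable_on_subinterval) (use that in auto)
  show "\<exists>\<delta>>0. \<forall>(n::nat) c d. (\<forall>i<n. a \<le> c i \<and> c i \<le> d i \<and> d i \<le> b) \<and>
      disjoint_family_on (\<lambda>i. {c i<..<d i}) {..<n} \<and> (\<Sum>i<n. d i - c i) < \<delta> \<longrightarrow>
      (\<Sum>i<n. norm (u (d i) - u (c i))) < e"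
  proof (intro exI[of _ "e / (2 * B)"] conjI allI impI, goal_cases)
    case 1
    show ?case using \<open>0 < e\<close> B by simp
  next
    case (2 n c d)
    then have cd: "a \<le> c i" "c i \<le> d i" "d i \<le> b" if "i < n" for i
      using that by auto
    have step: "norm (u (d i) - u (c i)) \<le> integral {c i..d i} h + B * (d i - c i)" if "i < n" for i
    proof -
      have "norm (integral {c i..d i} g) \<le> integral {c i..d i} (\<lambda>x. h x + B)"
      proof (rule integral_norm_bound_integral)
        show "g integrable_on {c i..d i}"
          using primitive_onD[OF prim cd[OF that]] by (auto simp: has_integral_iff)
        show "(\<lambda>x. h x + B) integrable_on {c i..d i}"
          using cd[OF that] by (intro integrable_add h_sub) auto
        show "norm (g x) \<le> h x + B" if "x \<in> {c i..d i}" for x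
        proof -
          have "norm (k x) \<le> B" using that cd[OF \<open>i < n\<close>] by (intro B) auto
          then show ?thesis
            using norm_triangle_ineq[of "g x - k x" "k x"] by (simp add: h_def)
        qed
      qed
      also have "\<dots> = integral {c i..d i} h + B * (d i - c i)"
        using cd[OF that] h_sub by (subst integral_add) auto
      finally show ?thesis
        using primitive_onD[OF prim cd[OF that]] by (auto simp: has_integral_iff)
    qed
    have "(h has_integral (\<Sum>i<n. integral {c i..d i} h)) (\<Union>i<n. {c i..d i})"
    proof (rule has_integral_UN)
      show "(h has_integral integral {c i..d i} h) {c i..d i}" if "i \<in> {..<n}" for i
        using that cd[of i] by (auto intro: integrable_integral h_sub)
      show "pairwise (\<lambda>i i'. negligible ({c i..d i} \<inter> {c i'..d i'})) {..<n}"
        unfolding pairwise_def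
      proof (intro ballI impI)
        fix i i' assume "i \<in> {..<n}" "i' \<in> {..<n}" "i \<noteq> i'"
        moreover from this have "{c i<..<d i} \<inter> {c i'<..<d i'} = {}"
          using 2 unfolding disjoint_family_on_def by blast
        ultimately show "negligible ({c i..d i} \<inter> {c i'..d i'})"
          using cd[of i] cd[of i'] by (intro negligible_Icc_overlap) auto
      qed
    qed auto
    moreover have "(\<Union>i<n. {c i..d i}) \<subseteq> {a..b}"
      using cd order_trans by (intro UN_least) fastforce
    ultimately have "(\<Sum>i<n. integral {c i..d i} h) \<le> integral {a..b} h"
      by (intro has_integral_subset_le[OF _ _ integrable_integral[OF h_int]]) (auto simp: h_def)
    moreover have "(\<Sum>i<n. B * (d i - c i)) < e / 2"
    proof -
      have "(\<Sum>i<n. B * (d i - c i)) = B * (\<Sum>i<n. d i - c i)"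
        by (simp only: sum_distrib_left)
      also have "\<dots> < B * (e / (2 * B))"
        using 2 B by (intro mult_strict_left_mono) auto
      finally show ?thesis using B by simp
    qed
    moreover have "(\<Sum>i<n. norm (u (d i) - u (c i))) \<le>
        (\<Sum>i<n. integral {c i..d i} h) + (\<Sum>i<n. B * (d i - c i))"
      using step by (auto simp: sum.distrib[symmetric] intro!: sum_mono)
    ultimately show ?case
      using k(2) unfolding h_def by linarith
  qed
qed

text \<open>By Henstock's lemma, the Riemann sums of \<open>norm f\<close> for a fine tagged division differ from
the sum of the norms of the integrals of \<open>f\<close> over the pieces, which is 0, by an arbitrarily small amount.
Hence \<open>norm f\<close> has integral 0.\<close>

lemma integral_zero_on_subintervals_AE_zero:
  fixes f :: "real \<Rightarrow> 'b::euclidean_space"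
  assumes f: "f absolutely_integrable_on {a..b}"
    and zero: "\<And>c d. a \<le> c \<Longrightarrow> c \<le> d \<Longrightarrow> d \<le> b \<Longrightarrow> integral {c..d} f = 0"
  shows "AE x in lebesgue. x \<in> {a..b} \<longrightarrow> f x = 0"
proof -
  have int_f: "f integrable_on cbox a b" and int_nf: "(\<lambda>x. norm (f x)) integrable_on cbox a b"
    using f by (auto simp: absolutely_integrable_on_def)
  have "integral {a..b} (\<lambda>x. norm (f x)) \<le> e" if "0 < e" for e
  proof -
    obtain \<gamma> where \<gamma>: "gauge \<gamma>" "\<And>p. p tagged_partial_division_of (cbox a b) \<Longrightarrow> \<gamma> fine p \<Longrightarrow>
             (\<Sum>(x,k)\<in>p. norm (measure lborel k *\<^sub>R f x - integral k f)) < e / 2"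
      using Henstock_lemma[OF int_f, of "e / 2"] \<open>0 < e\<close> by auto
    obtain \<gamma>' where \<gamma>': "gauge \<gamma>'" "\<And>p. p tagged_division_of (cbox a b) \<Longrightarrow> \<gamma>' fine p \<Longrightarrow>
             norm ((\<Sum>(x,k)\<in>p. measure lborel k *\<^sub>R norm (f x)) - integral (cbox a b) (\<lambda>x. norm (f x))) < e / 2"
      using integrable_integral[OF int_nf] \<open>0 < e\<close> unfolding has_integral by (meson half_gt_zero)
    obtain p where p: "p tagged_division_of (cbox a b)" "\<gamma> fine p" "\<gamma>' fine p"
      using fine_division_exists[OF gauge_Int[OF \<gamma>(1) \<gamma>'(1)], of a b] unfolding fine_Int by metis
    have "integral k f = 0" if "(x, k) \<in> p" for x k
    proof -
      have "\<exists>c d. k = {c..d}" "k \<subseteq> {a..b}"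
        using tagged_division_ofD(3,4)[OF p(1) \<open>(x, k) \<in> p\<close>] by auto
      then obtain c d where "k = {c..d}" "k \<subseteq> {a..b}" by blast
      then show ?thesis using zero[of c d] by (cases "c \<le> d") auto
    qed
    then have "(\<Sum>(x,k)\<in>p. measure lborel k *\<^sub>R norm (f x)) = (\<Sum>(x,k)\<in>p. norm (measure lborel k *\<^sub>R f x - integral k f))"
      by (intro sum.cong) auto
    also have "\<dots> < e / 2"
      using p tagged_division_of_def by (intro \<gamma>(2)) blast+
    finally show ?thesis using \<gamma>'(2)[OF p(1,3)] by (simp add: abs_if split: if_splits)
  qed
  then have "integral {a..b} (\<lambda>x. norm (f x)) \<le> 0" by (rule field_le_epsilon) simp
  moreover have "integral {a..b} (\<lambda>x. norm (f x)) \<ge> 0"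
    using int_nf by (intro integral_nonneg) auto
  ultimately have "(LINT x:{a..b}|lebesgue. norm (f x)) = 0"
    using set_lebesgue_integral_eq_integral(2)[OF absolutely_integrable_norm[OF f]] by (simp add: o_def)
  then have "AE x in lebesgue. indicator {a..b} x *\<^sub>R norm (f x) = 0"
    using absolutely_integrable_norm[OF f, unfolded o_def] unfolding set_lebesgue_integral_def set_integrable_def
    by (subst (asm) integral_nonneg_eq_0_iff_AE) auto
  then show ?thesis by eventually_elim (auto simp: indicator_def)
qed

lemma primitive_on_unique:
  assumes "primitive_on a b u g" "primitive_on a b u g'"
  shows "AE x in lebesgue. x \<in> {a..b} \<longrightarrow> g x = g' x"
proof -
  have "AE x in lebesgue. x \<in> {a..b} \<longrightarrow> g x - g' x = 0"
  proof (rule integral_zero_on_subintervals_AE_zero)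
    show "(\<lambda>x. g x - g' x) absolutely_integrable_on {a..b}"
      using assms unfolding primitive_on_def by (intro set_integral_diff) auto
    show "integral {c..d} (\<lambda>x. g x - g' x) = 0" if "a \<le> c" "c \<le> d" "d \<le> b" for c d
      using has_integral_diff[OF primitive_onD[OF assms(1) that] primitive_onD[OF assms(2) that]]
      by (simp add: has_integral_iff)
  qed
  then show ?thesis by simp
qed

section \<open>Weak derivatives and primitives\<close>

lemma test_function_continuous_derivative:
  assumes "test_function a b \<phi>"
  shows "(\<phi> has_real_derivative deriv \<phi> x) (at x)" "continuous_on A (deriv \<phi>)"
proof -
  have d: "((deriv ^^ k) \<phi>) differentiable (at x)" for k x
    using assms by (auto simp: test_function_def)
  from d[of 0] show "(\<phi> has_real_derivative deriv \<phi> x) (at x)"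
    by (simp add: DERIV_deriv_iff_real_differentiable)
  from d[of 1] show "continuous_on A (deriv \<phi>)"
    by (auto intro!: continuous_at_imp_continuous_on differentiable_imp_continuous_within)
qed

lemma set_integral_open_eq_integral:
  fixes f :: "real \<Rightarrow> 'b::euclidean_space"
  assumes "f absolutely_integrable_on {a..b}"
  shows "set_integrable lebesgue {a<..<b} f" "(LINT x:{a<..<b}|lebesgue. f x) = integral {a..b} f"
proof -
  show 1: "set_integrable lebesgue {a<..<b} f"
    using assms absolutely_integrable_on_Icc_iff_Ioo by blast
  show "(LINT x:{a<..<b}|lebesgue. f x) = integral {a..b} f"
    using set_lebesgue_integral_eq_integral(2)[OF 1] by (simp add: integral_open_interval_real)
qed

lemma continuous_scaleR_absolutely_integrable:
  fixes g :: "real \<Rightarrow> 'b::euclidean_space" and \<phi> :: "real \<Rightarrow> real"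
  assumes "continuous_on {a..b} \<phi>" "g absolutely_integrable_on {a..b}"
  shows "(\<lambda>t. \<phi> t *\<^sub>R g t) absolutely_integrable_on {a..b}"
  using assms
  by (intro absolutely_integrable_bounded_measurable_product[OF bilinear_conv_bounded_bilinear[THEN iffD2, OF bounded_bilinear_scaleR]])
    (auto intro!: continuous_imp_measurable_on_sets_lebesgue compact_imp_bounded compact_continuous_image)

lemma primitive_on_continuous:
  assumes "primitive_on a b u g"
  shows "continuous_on {a..b} u"
proof -
  have "g integrable_on {a..b}"
    by (rule set_lebesgue_integral_eq_integral(1)) (use assms in \<open>simp add: primitive_on_def\<close>)
  then have "continuous_on {a..b} (\<lambda>x. u a + integral {a..x} g)"
    by (intro continuous_intros indefinite_integral_continuous_1)
  moreover have "u a + integral {a..x} g = u x" if "x \<in> {a..b}" for x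
    using primitive_onD[OF assms, of a x] that by (auto simp: has_integral_iff)
  ultimately show ?thesis by (rule continuous_on_eq)
qed

text \<open>For a continuous \<open>g\<close> this is the product rule and the fundamental theorem of calculus. Both sides of
the identity depend on \<open>g\<close> continuously in \<open>L\<^sup>1\<close>, so the general case follows by approximation.\<close>

lemma primitive_on_weak_derivative:
  fixes u g :: "real \<Rightarrow> real ^ 'n"
  assumes prim: "primitive_on a b u g" and "a < b"
  shows "has_weak_derivative a b u g"
  unfolding has_weak_derivative_def
proof (intro conjI allI impI)
  have g: "g absolutely_integrable_on {a..b}" using prim by (simp add: primitive_on_def)
  have cont_u: "continuous_on {a..b} u" by (rule primitive_on_continuous[OF prim])
  have u: "u absolutely_integrable_on {a..b}"
    by (rule absolutely_integrable_continuous_real[OF cont_u])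
  show "set_integrable lebesgue {a<..<b} u" "set_integrable lebesgue {a<..<b} g"
    by (rule set_integral_open_eq_integral(1)[OF u], rule set_integral_open_eq_integral(1)[OF g])
  fix \<phi> assume test: "test_function a b \<phi>"
  note d\<phi> = test_function_continuous_derivative[OF test]
  have cont_\<phi>: "continuous_on A \<phi>" for A
    by (intro continuous_at_imp_continuous_on ballI DERIV_isCont[OF d\<phi>(1)])
  have ends: "\<phi> a = 0" "\<phi> b = 0"
    using test closure_subset[of "{x. \<phi> x \<noteq> 0}"] by (auto simp: test_function_def)
  define w where "w t = u t - u a" for t
  have cont_w: "continuous_on {a..b} w" unfolding w_def by (intro continuous_intros cont_u)
  have int_w: "(\<lambda>t. deriv \<phi> t *\<^sub>R w t) integrable_on {a..b}"
    by (intro integrable_continuous_real continuous_intros cont_w d\<phi>(2))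
  have abs_g: "(\<lambda>t. \<phi> t *\<^sub>R g t) absolutely_integrable_on {a..b}"
    by (rule continuous_scaleR_absolutely_integrable[OF cont_\<phi> g])
  then have int_g: "(\<lambda>t. \<phi> t *\<^sub>R g t) integrable_on {a..b}"
    by (rule set_lebesgue_integral_eq_integral)
  have "bounded (\<phi> ` {a..b} \<union> deriv \<phi> ` {a..b})"
    by (intro bounded_Un[THEN iffD2] conjI compact_imp_bounded compact_continuous_image cont_\<phi> d\<phi>(2)) auto
  then obtain C where C: "0 < C" "\<And>t. t \<in> {a..b} \<Longrightarrow> \<bar>\<phi> t\<bar> \<le> C" "\<And>t. t \<in> {a..b} \<Longrightarrow> \<bar>deriv \<phi> t\<bar> \<le> C"
    unfolding bounded_pos by auto
  have "norm (integral {a..b} (\<lambda>t. deriv \<phi> t *\<^sub>R w t + \<phi> t *\<^sub>R g t)) \<le> 0 + e" if "0 < e" for e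
  proof -
    \<comment> \<open>the error below is at most \<open>C * \<epsilon> * (b - a)\<close> from the primitives and \<open>C * \<epsilon>\<close> from the derivatives\<close>
    define \<epsilon> where "\<epsilon> = e / (C * (b - a + 1))"
    have "0 < \<epsilon>" using that C \<open>a < b\<close> by (simp add: \<epsilon>_def)
    obtain k where k: "continuous_on UNIV k" "integral {a..b} (\<lambda>x. norm (g x - k x)) < \<epsilon>"
      using L1_approx_continuous[OF g \<open>0 < \<epsilon>\<close>] by auto
    have cont_k: "continuous_on A k" for A using k(1) by (rule continuous_on_subset) simp
    define U where "U t = integral {a..t} k" for t
    have dU: "(U has_vector_derivative k t) (at t within {a..b})" if "t \<in> {a..b}" for t
      unfolding U_def by (rule integral_has_vector_derivative[OF cont_k that])
    have cont_U: "continuous_on {a..b} U"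
      unfolding U_def by (intro indefinite_integral_continuous_1 integrable_continuous_real cont_k)
    have "((\<lambda>t. deriv \<phi> t *\<^sub>R U t + \<phi> t *\<^sub>R k t) has_integral (\<phi> b *\<^sub>R U b - \<phi> a *\<^sub>R U a)) {a..b}"
    proof (rule fundamental_theorem_of_calculus)
      show "((\<lambda>t. \<phi> t *\<^sub>R U t) has_vector_derivative deriv \<phi> t *\<^sub>R U t + \<phi> t *\<^sub>R k t) (at t within {a..b})"
        if "t \<in> {a..b}" for t
        using has_vector_derivative_scaleR[OF has_field_derivative_at_within[OF d\<phi>(1)] dU[OF that]]
        by (simp add: add.commute)
    qed (use \<open>a < b\<close> in simp)
    then have smooth: "integral {a..b} (\<lambda>t. deriv \<phi> t *\<^sub>R U t + \<phi> t *\<^sub>R k t) = 0"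
      "(\<lambda>t. deriv \<phi> t *\<^sub>R U t + \<phi> t *\<^sub>R k t) integrable_on {a..b}"
      using ends by (auto simp: has_integral_iff)
    have abs_gk: "(\<lambda>t. g t - k t) absolutely_integrable_on {a..b}"
      by (intro set_integral_diff(1)[OF g] absolutely_integrable_continuous_real cont_k)
    then have int_gk: "(\<lambda>t. norm (g t - k t)) integrable_on {a..b}"
      unfolding absolutely_integrable_on_def by simp
    have close: "norm (w t - U t) \<le> \<epsilon>" if "t \<in> {a..b}" for t
    proof -
      have "(\<lambda>s. g s - k s) integrable_on {a..b}"
        using abs_gk by (rule set_lebesgue_integral_eq_integral)
      then have "(\<lambda>s. g s - k s) integrable_on {a..t}" "(\<lambda>s. norm (g s - k s)) integrable_on {a..t}"
        by (rule integrable_on_subinterval, use that in simp)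
          (rule integrable_on_subinterval[OF int_gk], use that in simp)
      then have "norm (integral {a..t} (\<lambda>s. g s - k s)) \<le> integral {a..t} (\<lambda>s. norm (g s - k s))"
        by (rule integral_norm_bound_integral) auto
      also have "\<dots> \<le> integral {a..b} (\<lambda>s. norm (g s - k s))"
        using that \<open>(\<lambda>s. norm (g s - k s)) integrable_on {a..t}\<close> int_gk by (intro integral_subset_le) auto
      also have "integral {a..t} (\<lambda>s. g s - k s) = w t - U t"
      proof -
        have g_t: "(g has_integral w t) {a..t}"
          using primitive_onD[OF prim, of a t] that by (simp add: w_def)
        have k_t: "(k has_integral U t) {a..t}"
          unfolding U_def by (intro integrable_integral integrable_continuous_real cont_k)
        show ?thesis
          by (rule integral_unique[OF has_integral_diff[OF g_t k_t]])
      qed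
      finally show ?thesis using k(2) by simp
    qed
    have E: "integral {a..b} (\<lambda>t. deriv \<phi> t *\<^sub>R w t + \<phi> t *\<^sub>R g t) =
        integral {a..b} (\<lambda>t. (deriv \<phi> t *\<^sub>R w t + \<phi> t *\<^sub>R g t) - (deriv \<phi> t *\<^sub>R U t + \<phi> t *\<^sub>R k t))"
      using integral_diff[OF integrable_add[OF int_w int_g] smooth(2)] smooth(1) by simp
    have "norm (integral {a..b} (\<lambda>t. deriv \<phi> t *\<^sub>R w t + \<phi> t *\<^sub>R g t))
        \<le> integral {a..b} (\<lambda>t. C * \<epsilon> + C * norm (g t - k t))"
      unfolding E
    proof (rule integral_norm_bound_integral)
      show "(\<lambda>t. deriv \<phi> t *\<^sub>R w t + \<phi> t *\<^sub>R g t - (deriv \<phi> t *\<^sub>R U t + \<phi> t *\<^sub>R k t)) integrable_on {a..b}"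
        by (intro integrable_diff integrable_add int_w int_g smooth(2))
      show "(\<lambda>t. C * \<epsilon> + C * norm (g t - k t)) integrable_on {a..b}"
        by (intro integrable_add integrable_const_ivl integrable_on_mult_right int_gk)
      fix t assume t: "t \<in> {a..b}"
      have "norm (deriv \<phi> t *\<^sub>R w t + \<phi> t *\<^sub>R g t - (deriv \<phi> t *\<^sub>R U t + \<phi> t *\<^sub>R k t)) =
          norm (deriv \<phi> t *\<^sub>R (w t - U t) + \<phi> t *\<^sub>R (g t - k t))"
        by (simp add: algebra_simps)
      also have "\<dots> \<le> \<bar>deriv \<phi> t\<bar> * norm (w t - U t) + \<bar>\<phi> t\<bar> * norm (g t - k t)"
        by (rule order_trans[OF norm_triangle_ineq]) simp
      also have "\<dots> \<le> C * \<epsilon> + C * norm (g t - k t)"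
        using C t close[OF t] by (intro add_mono mult_mono) auto
      finally show "norm (deriv \<phi> t *\<^sub>R w t + \<phi> t *\<^sub>R g t - (deriv \<phi> t *\<^sub>R U t + \<phi> t *\<^sub>R k t))
          \<le> C * \<epsilon> + C * norm (g t - k t)" .
    qed
    also have "\<dots> = C * \<epsilon> * (b - a) + C * integral {a..b} (\<lambda>t. norm (g t - k t))"
      using integral_add[OF integrable_const_ivl integrable_on_mult_right[OF int_gk], of "C * \<epsilon>" C] \<open>a < b\<close>
      by simp
    also have "\<dots> \<le> C * \<epsilon> * (b - a) + C * \<epsilon>"
      using k(2) C by simp
    also have "\<dots> = C * (b - a + 1) * \<epsilon>" by (simp add: algebra_simps)
    also have "\<dots> = e"
      using C \<open>a < b\<close> by (simp add: \<epsilon>_def)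
    finally show ?thesis by simp
  qed
  then have "norm (integral {a..b} (\<lambda>t. deriv \<phi> t *\<^sub>R w t + \<phi> t *\<^sub>R g t)) \<le> 0"
    by (rule field_le_epsilon)
  then have "integral {a..b} (\<lambda>t. deriv \<phi> t *\<^sub>R w t) = - integral {a..b} (\<lambda>t. \<phi> t *\<^sub>R g t)"
    using integral_add[OF int_w int_g] by (simp add: eq_neg_iff_add_eq_0)
  moreover have "integral {a..b} (\<lambda>t. deriv \<phi> t *\<^sub>R w t) = integral {a..b} (\<lambda>t. deriv \<phi> t *\<^sub>R u t)"
  proof -
    have "(deriv \<phi> has_integral (\<phi> b - \<phi> a)) {a..b}"
      using \<open>a < b\<close> has_field_derivative_at_within[OF d\<phi>(1)]
      by (intro fundamental_theorem_of_calculus)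
        (simp_all only: less_imp_le flip: has_real_derivative_iff_has_vector_derivative)
    then have "((\<lambda>t. deriv \<phi> t *\<^sub>R u a) has_integral 0) {a..b}"
      using has_integral_scaleR_left[of "deriv \<phi>" "\<phi> b - \<phi> a" "{a..b}" "u a"] ends by simp
    from has_integral_add[OF integrable_integral[OF int_w] this]
    have "((\<lambda>t. deriv \<phi> t *\<^sub>R u t) has_integral integral {a..b} (\<lambda>t. deriv \<phi> t *\<^sub>R w t)) {a..b}"
      by (simp add: w_def scaleR_diff_right)
    from integral_unique[OF this] show ?thesis by simp
  qed
  moreover have "(LINT t:{a<..<b}|lebesgue. deriv \<phi> t *\<^sub>R u t) = integral {a..b} (\<lambda>t. deriv \<phi> t *\<^sub>R u t)"
    by (intro set_integral_open_eq_integral(2) absolutely_integrable_continuous_real continuous_intros cont_u d\<phi>(2))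
  moreover have "(LINT t:{a<..<b}|lebesgue. \<phi> t *\<^sub>R g t) = integral {a..b} (\<lambda>t. \<phi> t *\<^sub>R g t)"
    by (rule set_integral_open_eq_integral(2)[OF abs_g])
  ultimately show "(LINT t:{a<..<b}|lebesgue. deriv \<phi> t *\<^sub>R u t) = - (LINT t:{a<..<b}|lebesgue. \<phi> t *\<^sub>R g t)"
    by simp
qed

lemma absolutely_continuous_on_Icc_imp_continuous:
  assumes "absolutely_continuous_on_Icc a b u"
  shows "continuous_on {a..b} u"
  unfolding continuous_on_iff
proof (intro ballI allI impI)
  fix s e :: real assume s: "s \<in> {a..b}" and "0 < e"
  from assms[unfolded absolutely_continuous_on_Icc_def, rule_format, OF \<open>0 < e\<close>]
  obtain \<delta> where "0 < \<delta>" and \<delta>: "\<And>(k::nat) c d. (\<forall>i<k. a \<le> c i \<and> c i \<le> d i \<and> d i \<le> b) \<and>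
      disjoint_family_on (\<lambda>i. {c i<..<d i}) {..<k} \<and> (\<Sum>i<k. d i - c i) < \<delta> \<Longrightarrow>
      (\<Sum>i<k. norm (u (d i) - u (c i))) < e"
    by blast
  have "norm (u t - u s) < e" if "t \<in> {a..b}" "\<bar>t - s\<bar> < \<delta>" for t
    using \<delta>[of 1 "\<lambda>_. min s t" "\<lambda>_. max s t"] s that
    by (cases "s \<le> t") (auto simp: disjoint_family_on_def norm_minus_commute)
  with \<open>0 < \<delta>\<close> show "\<exists>d>0. \<forall>t\<in>{a..b}. dist t s < d \<longrightarrow> dist (u t) (u s) < e"
    by (auto simp: dist_norm)
qed

lemma smooth_step_bounds:
  fixes S S' :: "real \<Rightarrow> real"
  assumes dS: "\<And>x. (S has_real_derivative S' x) (at x)" and nonneg: "\<And>x. S' x \<ge> 0"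
    and S0: "\<And>x. x \<le> -1 \<Longrightarrow> S x = 0" and S1: "\<And>x. x \<ge> 1 \<Longrightarrow> S x = 1"
  shows "0 \<le> S x" "S x \<le> 1"
proof -
  have mono: "S x \<le> S y" if "x \<le> y" for x y
    by (rule DERIV_nonneg_imp_nondecreasing[of _ _ S, OF that]) (use dS nonneg in auto)
  show "0 \<le> S x" using mono[of "min x (-1)" x] S0[of "min x (-1)"] by simp
  show "S x \<le> 1" using mono[of x "max x 1"] S1[of "max x 1"] by simp
qed

text \<open>The rescaled bumps are nonnegative, have integral 1 and are supported at distance at most \<open>1 / n\<close> from
\<open>z\<close>, so integrating against them averages \<open>v\<close> near \<open>z\<close>.\<close>

lemma step_derivative_concentrates:
  fixes v :: "real \<Rightarrow> 'b::euclidean_space" and S S' :: "real \<Rightarrow> real"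
  assumes dS: "\<And>x. (S has_real_derivative S' x) (at x)" and cont_S': "continuous_on UNIV S'"
    and nonneg: "\<And>x. S' x \<ge> 0"
    and S0: "\<And>x. x \<le> -1 \<Longrightarrow> S x = 0" and S1: "\<And>x. x \<ge> 1 \<Longrightarrow> S x = 1"
    and supp: "\<And>x. \<bar>x\<bar> \<ge> 1 \<Longrightarrow> S' x = 0"
    and v: "continuous_on {a..b} v" and z: "a < z" "z < b"
  shows "(\<lambda>n. integral {a..b} (\<lambda>t. (real n * S' (real n * t + - (real n * z))) *\<^sub>R v t)) \<longlonglongrightarrow> v z"
proof (rule metric_LIMSEQ_I)
  fix e :: real assume "0 < e"
  then obtain d where "0 < d" and d: "\<And>t. t \<in> {a..b} \<Longrightarrow> \<bar>t - z\<bar> < d \<Longrightarrow> norm (v t - v z) < e / 2"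
    using v z unfolding continuous_on_iff dist_norm real_norm_def
    by (metis atLeastAtMost_iff half_gt_zero less_eq_real_def)
  obtain N where N: "max (1 / d) (max (1 / (z - a)) (1 / (b - z))) < real N"
    using reals_Archimedean2 by blast
  have "dist (integral {a..b} (\<lambda>t. (real m * S' (real m * t + - (real m * z))) *\<^sub>R v t)) (v z) < e"
    if "m \<ge> N" for m
  proof -
    define n where "n = real m"
    have "real N \<le> n" using that by (simp add: n_def)
    with N have n: "1 / d < n" "1 / (z - a) < n" "1 / (b - z) < n" by auto
    moreover have "0 < 1 / d" using \<open>0 < d\<close> by simp
    ultimately have "0 < n" by linarith
    define k where "k t = n * S' (n * t + - (n * z))" for t
    have cont_k: "continuous_on {a..b} k"
      unfolding k_def by (intro continuous_intros continuous_on_compose2[OF cont_S']) auto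
    have k_nonneg: "0 \<le> k t" for t using \<open>0 < n\<close> nonneg by (simp add: k_def)
    have "1 \<le> n * (z - a)" "1 \<le> n * (b - z)"
      using n z by (simp_all add: divide_less_eq)
    then have "S (n * b + - (n * z)) = 1" "S (n * a + - (n * z)) = 0"
      by (intro S0 S1; simp add: algebra_simps)+
    moreover have "(k has_integral (S (n * b + - (n * z)) - S (n * a + - (n * z)))) {a..b}"
    proof (rule fundamental_theorem_of_calculus)
      show "((\<lambda>t. S (n * t + - (n * z))) has_vector_derivative k t) (at t within {a..b})" for t
        unfolding has_real_derivative_iff_has_vector_derivative[symmetric] k_def
        by (rule has_field_derivative_at_within, rule DERIV_cong, rule DERIV_chain2[OF dS])
          (auto intro!: derivative_eq_intros)
    qed (use z in simp)
    ultimately have k1: "(k has_integral 1) {a..b}" by simp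
    have int_kv: "(\<lambda>t. k t *\<^sub>R v t) integrable_on {a..b}"
      by (intro integrable_continuous_real continuous_intros cont_k v)
    have "((\<lambda>t. k t *\<^sub>R v z) has_integral 1 *\<^sub>R v z) {a..b}"
      by (rule has_integral_scaleR_left[OF k1])
    then have diff: "((\<lambda>t. k t *\<^sub>R v t - k t *\<^sub>R v z) has_integral (integral {a..b} (\<lambda>t. k t *\<^sub>R v t) - v z)) {a..b}"
      using has_integral_diff[OF integrable_integral[OF int_kv]] by simp
    have "norm (integral {a..b} (\<lambda>t. k t *\<^sub>R v t) - v z) \<le> integral {a..b} (\<lambda>t. k t * (e / 2))"
      unfolding integral_unique[OF diff, symmetric]
    proof (rule integral_norm_bound_integral)
      show "(\<lambda>t. k t *\<^sub>R v t - k t *\<^sub>R v z) integrable_on {a..b}"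
        using diff by blast
      show "(\<lambda>t. k t * (e / 2)) integrable_on {a..b}"
        by (intro integrable_continuous_real continuous_intros cont_k)
      show "norm (k t *\<^sub>R v t - k t *\<^sub>R v z) \<le> k t * (e / 2)" if t: "t \<in> {a..b}" for t
      proof (cases "\<bar>n * t + - (n * z)\<bar> \<ge> 1")
        case True
        then show ?thesis by (simp add: k_def supp)
      next
        case False
        have "\<bar>n * t + - (n * z)\<bar> = n * \<bar>t - z\<bar>"
          using \<open>0 < n\<close> by (simp add: abs_mult_pos' right_diff_distrib)
        with False have "\<bar>t - z\<bar> < 1 / n" using \<open>0 < n\<close> by (simp add: field_simps)
        also have "1 / n < d" using n(1) \<open>0 < d\<close> \<open>0 < n\<close> by (simp add: field_simps)
        finally have "norm (v t - v z) < e / 2" by (rule d[OF t])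
        then have "k t * norm (v t - v z) \<le> k t * (e / 2)"
          by (intro mult_left_mono k_nonneg) simp
        then show ?thesis
          using k_nonneg[of t] by (simp flip: scaleR_diff_right)
      qed
    qed
    also have "\<dots> = e / 2"
      using has_integral_mult_left[OF k1, of "e / 2"] by (simp add: has_integral_iff)
    also have "\<dots> < e" using \<open>0 < e\<close> by simp
    finally show ?thesis by (simp add: dist_norm k_def n_def)
  qed
  then show "\<exists>N. \<forall>m\<ge>N. dist (integral {a..b} (\<lambda>t. (real m * S' (real m * t + - (real m * z))) *\<^sub>R v t)) (v z) < e"
    by blast
qed

text \<open>Test the weak derivative with a smooth approximation of the indicator function of \<open>{x..y}\<close>. In the limit
one side becomes the integral of \<open>g\<close> over \<open>{x..y}\<close>, and the other the difference of the values of \<open>v\<close>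
at the ends.\<close>

lemma weak_derivative_increment:
  fixes v g :: "real \<Rightarrow> real ^ 'n"
  assumes weak: "has_weak_derivative a b v g" and v: "continuous_on {a..b} v"
    and xy: "a < x" "x < y" "y < b"
  shows "integral {x..y} g = v y - v x"
proof -
  have g_open: "set_integrable lebesgue {a<..<b} g"
    using weak by (simp add: has_weak_derivative_def)
  then have g: "g absolutely_integrable_on {a..b}"
    using absolutely_integrable_on_Icc_iff_Ioo by blast
  obtain S S' :: "real \<Rightarrow> real" where S_alg: "S \<in> bump_algebra"
    and dS: "\<And>x. (S has_real_derivative S' x) (at x)" and cont_S': "continuous_on UNIV S'"
    and nonneg: "\<And>x. S' x \<ge> 0"
    and S0: "\<And>x. x \<le> -1 \<Longrightarrow> S x = 0" and S1: "\<And>x. x \<ge> 1 \<Longrightarrow> S x = 1"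
    and supp: "\<And>x. \<bar>x\<bar> \<ge> 1 \<Longrightarrow> S' x = 0"
    using smooth_step_exists by metis
  note bounds = smooth_step_bounds[OF dS nonneg S0 S1]
  define \<sigma> where "\<sigma> z n t = S (real n * t + - (real n * z))" for z t :: real and n :: nat
  define \<sigma>' where "\<sigma>' z n t = real n * S' (real n * t + - (real n * z))" for z t :: real and n :: nat
  \<comment> \<open>a smooth plateau over \<open>{x..y}\<close>, written as a sum and product to match the rules of the algebra\<close>
  define \<phi> where "\<phi> n t = \<sigma> x n t + (\<lambda>_. -1) t * \<sigma> y n t" for n t
  have d\<sigma>: "(\<sigma> z n has_real_derivative \<sigma>' z n t) (at t)" for z n t
    unfolding \<sigma>_def \<sigma>'_def
    by (rule DERIV_cong, rule DERIV_chain2[OF dS]) (auto intro!: derivative_eq_intros)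
  have cont_\<sigma>': "continuous_on A (\<sigma>' z n)" for A z n
    unfolding \<sigma>'_def by (intro continuous_intros continuous_on_compose2[OF cont_S']) auto
  have \<phi>_alg: "\<phi> n \<in> bump_algebra" for n
    unfolding \<phi>_def \<sigma>_def
    by (intro bump_algebra.add bump_algebra.mult bump_algebra.const bump_algebra.affine[OF S_alg])
  have "((\<phi> n) has_real_derivative (\<sigma>' x n t - \<sigma>' y n t)) (at t)" for n t
    unfolding \<phi>_def by (rule DERIV_cong[OF DERIV_add[OF d\<sigma> DERIV_mult[OF DERIV_const d\<sigma>]]]) simp
  then have deriv_\<phi>: "deriv (\<phi> n) t = \<sigma>' x n t - \<sigma>' y n t" for n t
    by (rule DERIV_imp_deriv)
  have cont_\<phi>: "continuous_on A (\<phi> n)" for A n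
    unfolding \<phi>_def
    by (intro continuous_at_imp_continuous_on ballI continuous_intros DERIV_isCont[OF d\<sigma>])
  have \<phi>_bound: "\<bar>\<phi> n t\<bar> \<le> 1" for n t
    using bounds(1)[of "real n * t + - (real n * x)"] bounds(2)[of "real n * t + - (real n * x)"]
      bounds(1)[of "real n * t + - (real n * y)"] bounds(2)[of "real n * t + - (real n * y)"]
    by (simp add: \<phi>_def \<sigma>_def)
  have \<sigma>_left: "\<sigma> z n t = 0" if "1 \<le> real n * (z - t)" for z n t
    unfolding \<sigma>_def by (rule S0) (use that in \<open>simp add: algebra_simps\<close>)
  have \<sigma>_right: "\<sigma> z n t = 1" if "1 \<le> real n * (t - z)" for z n t
    unfolding \<sigma>_def by (rule S1) (use that in \<open>simp add: algebra_simps\<close>)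
  have ev_large: "\<forall>\<^sub>F n in sequentially. 1 \<le> real n * r" if "0 < r" for r
  proof -
    obtain N where "1 / r < real N" using reals_Archimedean2 by blast
    then have "1 \<le> real n * r" if "n \<ge> N" for n
    proof -
      have "1 \<le> real N * r" using \<open>1 / r < real N\<close> \<open>0 < r\<close> by (simp add: divide_less_eq)
      also have "\<dots> \<le> real n * r" using that \<open>0 < r\<close> by (intro mult_right_mono) auto
      finally show ?thesis .
    qed
    then show ?thesis by (rule eventually_sequentiallyI)
  qed
  \<comment> \<open>the pointwise limit of the steps; the value \<open>S 0\<close> at \<open>z\<close> itself does not affect integrals\<close>
  define c where "c z t = (if t < z then 0 else if t = z then S 0 else 1)" for z t :: real
  have lim_\<sigma>: "(\<lambda>n. \<sigma> z n t) \<longlonglongrightarrow> c z t" for z t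
  proof (rule tendsto_eventually)
    consider "t < z" | "t = z" | "z < t" by linarith
    then show "\<forall>\<^sub>F n in sequentially. \<sigma> z n t = c z t"
    proof cases
      case 1
      then have "\<forall>\<^sub>F n in sequentially. 1 \<le> real n * (z - t)" by (intro ev_large) simp
      then show ?thesis by eventually_elim (use 1 in \<open>simp add: \<sigma>_left c_def\<close>)
    next
      case 2
      then show ?thesis by (simp add: \<sigma>_def c_def)
    next
      case 3
      then have "\<forall>\<^sub>F n in sequentially. 1 \<le> real n * (t - z)" by (intro ev_large) simp
      then show ?thesis by eventually_elim (use 3 in \<open>simp add: \<sigma>_right c_def\<close>)
    qed
  qed
  define \<psi> where "\<psi> t = c x t - c y t" for t
  have lim_\<phi>: "(\<lambda>n. \<phi> n t) \<longlonglongrightarrow> \<psi> t" for t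
    unfolding \<phi>_def \<psi>_def using tendsto_diff[OF lim_\<sigma>[of x t] lim_\<sigma>[of y t]] by simp
  define r where "r = min (x - a) (b - y) / 2"
  have "0 < r" using xy by (simp add: r_def)
  have "r \<le> (x - a) / 2" "r \<le> (b - y) / 2" by (simp_all add: r_def)
  then have r: "a < x - r" "y + r < b" using xy by simp_all
  have test: "\<forall>\<^sub>F n in sequentially. test_function a b (\<phi> n)"
    using ev_large[OF \<open>0 < r\<close>]
  proof eventually_elim
    case (elim n)
    have "\<phi> n t = 0" if "t \<notin> {x - r..y + r}" for t
    proof -
      consider "t < x - r" | "t > y + r" using \<open>t \<notin> {x - r..y + r}\<close> by fastforce
      then show ?thesis
      proof cases
        case 1
        then have "real n * r \<le> real n * (x - t)" "real n * r \<le> real n * (y - t)"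
          using xy by (auto intro!: mult_left_mono)
        then show ?thesis using elim by (simp add: \<phi>_def \<sigma>_left)
      next
        case 2
        then have "real n * r \<le> real n * (t - x)" "real n * r \<le> real n * (t - y)"
          using xy by (auto intro!: mult_left_mono)
        then show ?thesis using elim by (simp add: \<phi>_def \<sigma>_right)
      qed
    qed
    then have "{t. \<phi> n t \<noteq> 0} \<subseteq> {x - r..y + r}" by blast
    then have "closure {t. \<phi> n t \<noteq> 0} \<subseteq> {x - r..y + r}"
      by (rule closure_minimal) simp
    also have "\<dots> \<subseteq> {a<..<b}" using r by auto
    finally show ?case
      using bump_algebra_smooth[OF \<phi>_alg] by (simp add: test_function_def)
  qed
  have "(\<lambda>n. LINT t:{a<..<b}|lebesgue. \<phi> n t *\<^sub>R g t) \<longlonglongrightarrow> (LINT t:{a<..<b}|lebesgue. \<psi> t *\<^sub>R g t)"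
    unfolding set_lebesgue_integral_def
  proof (rule integral_dominated_convergence[where w = "\<lambda>t. norm (indicator {a<..<b} t *\<^sub>R g t)"])
    have meas: "(\<lambda>t. indicator {a<..<b} t *\<^sub>R (\<phi> n t *\<^sub>R g t)) \<in> borel_measurable lebesgue" for n
      using set_integral_open_eq_integral(1)[OF continuous_scaleR_absolutely_integrable[OF cont_\<phi>[of "{a..b}" n] g]]
      unfolding set_integrable_def by auto
    then show "(\<lambda>t. indicator {a<..<b} t *\<^sub>R (\<phi> n t *\<^sub>R g t)) \<in> borel_measurable lebesgue" for n .
    have lim: "(\<lambda>n. indicator {a<..<b} t *\<^sub>R (\<phi> n t *\<^sub>R g t)) \<longlonglongrightarrow> indicator {a<..<b} t *\<^sub>R (\<psi> t *\<^sub>R g t)" for t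
      by (intro tendsto_intros lim_\<phi>)
    then show "AE t in lebesgue. (\<lambda>n. indicator {a<..<b} t *\<^sub>R (\<phi> n t *\<^sub>R g t)) \<longlonglongrightarrow> indicator {a<..<b} t *\<^sub>R (\<psi> t *\<^sub>R g t)"
      by simp
    show "(\<lambda>t. indicator {a<..<b} t *\<^sub>R (\<psi> t *\<^sub>R g t)) \<in> borel_measurable lebesgue"
      by (rule borel_measurable_LIMSEQ_metric[OF meas lim])
    show "integrable lebesgue (\<lambda>t. norm (indicator {a<..<b} t *\<^sub>R g t))"
      using g_open unfolding set_integrable_def by (rule integrable_norm)
    show "AE t in lebesgue. norm (indicator {a<..<b} t *\<^sub>R (\<phi> n t *\<^sub>R g t)) \<le> norm (indicator {a<..<b} t *\<^sub>R g t)" for n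
      using \<phi>_bound[of n] by (auto simp: indicator_def mult_left_le_one_le)
  qed
  moreover have "(\<lambda>n. LINT t:{a<..<b}|lebesgue. \<phi> n t *\<^sub>R g t) \<longlonglongrightarrow> v y - v x"
  proof -
    have lim: "(\<lambda>n. integral {a..b} (\<lambda>t. \<sigma>' z n t *\<^sub>R v t)) \<longlonglongrightarrow> v z" if "a < z" "z < b" for z
      unfolding \<sigma>'_def by (rule step_derivative_concentrates[OF dS cont_S' nonneg S0 S1 supp v that])
    have "(\<lambda>n. integral {a..b} (\<lambda>t. \<sigma>' y n t *\<^sub>R v t) - integral {a..b} (\<lambda>t. \<sigma>' x n t *\<^sub>R v t)) \<longlonglongrightarrow> v y - v x"
      using xy by (intro tendsto_diff lim) auto
    moreover have "\<forall>\<^sub>F n in sequentially. integral {a..b} (\<lambda>t. \<sigma>' y n t *\<^sub>R v t) - integral {a..b} (\<lambda>t. \<sigma>' x n t *\<^sub>R v t)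
        = (LINT t:{a<..<b}|lebesgue. \<phi> n t *\<^sub>R g t)"
      using test
    proof eventually_elim
      case (elim n)
      have int: "(\<lambda>t. \<sigma>' z n t *\<^sub>R v t) integrable_on {a..b}" for z
        by (intro integrable_continuous_real continuous_intros cont_\<sigma>' v)
      have "(LINT t:{a<..<b}|lebesgue. deriv (\<phi> n) t *\<^sub>R v t) = integral {a..b} (\<lambda>t. (\<sigma>' x n t - \<sigma>' y n t) *\<^sub>R v t)"
        unfolding deriv_\<phi>
        by (intro set_integral_open_eq_integral(2) absolutely_integrable_continuous_real continuous_intros cont_\<sigma>' v)
      also have "\<dots> = integral {a..b} (\<lambda>t. \<sigma>' x n t *\<^sub>R v t) - integral {a..b} (\<lambda>t. \<sigma>' y n t *\<^sub>R v t)"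
        using integral_diff[OF int int] by (simp add: scaleR_diff_left)
      finally have "integral {a..b} (\<lambda>t. \<sigma>' x n t *\<^sub>R v t) - integral {a..b} (\<lambda>t. \<sigma>' y n t *\<^sub>R v t)
          = - (LINT t:{a<..<b}|lebesgue. \<phi> n t *\<^sub>R g t)"
        using weak elim unfolding has_weak_derivative_def by simp
      then have "- (integral {a..b} (\<lambda>t. \<sigma>' x n t *\<^sub>R v t) - integral {a..b} (\<lambda>t. \<sigma>' y n t *\<^sub>R v t))
          = (LINT t:{a<..<b}|lebesgue. \<phi> n t *\<^sub>R g t)"
        by (simp only: minus_minus)
      then show ?case by (simp only: minus_diff_eq)
    qed
    ultimately show ?thesis by (rule Lim_transform_eventually)
  qed
  ultimately have lim_eq: "(LINT t:{a<..<b}|lebesgue. \<psi> t *\<^sub>R g t) = v y - v x"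
    by (rule LIMSEQ_unique)
  have sub: "{x..y} \<subseteq> {a..b}" using xy by simp
  have "(g has_integral integral {x..y} g) {x..y}"
    by (intro integrable_integral integrable_on_subinterval[OF _ sub]
        set_lebesgue_integral_eq_integral(1)[OF g])
  then have "((\<lambda>t. if t \<in> {x..y} then g t else 0) has_integral integral {x..y} g) {a..b}"
    by (simp only: has_integral_restrict[OF sub])
  then have "((\<lambda>t. \<psi> t *\<^sub>R g t) has_integral integral {x..y} g) {a..b}"
    by (rule has_integral_spike_finite[of "{x, y}", rotated 2])
      (use xy in \<open>simp_all add: \<psi>_def c_def\<close>)
  then have "((\<lambda>t. \<psi> t *\<^sub>R g t) has_integral integral {x..y} g) {a<..<b}"
    using has_integral_Icc_iff_Ioo by blast
  moreover have "set_integrable lebesgue {a<..<b} (\<lambda>t. \<psi> t *\<^sub>R g t)"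
  proof (rule set_integrable_bound[OF g_open])
    show "set_borel_measurable lebesgue {a<..<b} (\<lambda>t. \<psi> t *\<^sub>R g t)"
      unfolding set_borel_measurable_def
    proof (rule borel_measurable_LIMSEQ_metric)
      show "(\<lambda>t. indicator {a<..<b} t *\<^sub>R (\<phi> n t *\<^sub>R g t)) \<in> borel_measurable lebesgue" for n
        using set_integral_open_eq_integral(1)[OF continuous_scaleR_absolutely_integrable[OF cont_\<phi>[of "{a..b}" n] g]]
        unfolding set_integrable_def by auto
      show "(\<lambda>n. indicator {a<..<b} t *\<^sub>R (\<phi> n t *\<^sub>R g t)) \<longlonglongrightarrow> indicator {a<..<b} t *\<^sub>R (\<psi> t *\<^sub>R g t)" for t
        by (intro tendsto_intros lim_\<phi>)
    qed
    have "\<bar>\<psi> t\<bar> \<le> 1" for t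
      by (rule LIMSEQ_le_const2[OF tendsto_rabs[OF lim_\<phi>]]) (use \<phi>_bound in auto)
    then show "AE t in lebesgue. t \<in> {a<..<b} \<longrightarrow> norm (\<psi> t *\<^sub>R g t) \<le> norm (g t)"
      by (auto simp: mult_left_le_one_le)
  qed
  ultimately show ?thesis
    using lim_eq by (simp add: set_lebesgue_integral_eq_integral(2) integral_unique)
qed

text \<open>Increments over inner intervals determine \<open>v\<close> up to a constant on the open interval; continuity
extends the formula to the end points.\<close>

lemma weak_derivative_primitive:
  fixes v g :: "real \<Rightarrow> real ^ 'n"
  assumes weak: "has_weak_derivative a b v g" and v: "continuous_on {a..b} v" and "a < b"
  shows "primitive_on a b v g"
proof (rule primitive_onI)
  show g: "g absolutely_integrable_on {a..b}"
    using weak absolutely_integrable_on_Icc_iff_Ioo unfolding has_weak_derivative_def by blast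
  note g_int = set_lebesgue_integral_eq_integral(1)[OF g]
  define H where "H r = v r - integral {a..r} g" for r
  have cont: "continuous_on (closure {a<..<b}) H"
    unfolding H_def using \<open>a < b\<close> g_int
    by (auto simp: closure_greaterThanLessThan intro!: continuous_intros v indefinite_integral_continuous_1)
  have step: "H x = H y" if "a < x" "x < y" "y < b" for x y
  proof -
    have "integral {a..x} g + integral {x..y} g = integral {a..y} g"
      using that by (intro Henstock_Kurzweil_Integration.integral_combine integrable_on_subinterval[OF g_int]) auto
    then show ?thesis
      using weak_derivative_increment[OF weak v that] by (simp add: H_def algebra_simps)
  qed
  define z where "z = (a + b) / 2"
  have z: "a < z" "z < b" using \<open>a < b\<close> by (auto simp: z_def)
  have inner: "H r = H z" if "r \<in> {a<..<b}" for r
  proof (cases r z rule: linorder_cases)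
    case less
    show ?thesis by (rule step) (use that z less in auto)
  next
    case greater
    show ?thesis by (rule step[symmetric]) (use that z greater in auto)
  qed simp
  have const: "H r = H z" if "r \<in> closure {a<..<b}" for r
    by (rule continuous_constant_on_closure[OF cont inner that])
  have "a \<in> closure {a<..<b}" using \<open>a < b\<close> by (simp add: closure_greaterThanLessThan)
  fix r assume r: "a \<le> r" "r \<le> b"
  then have "r \<in> closure {a<..<b}" using \<open>a < b\<close> by (simp add: closure_greaterThanLessThan)
  then have "H r = H a" using const[of r] const[OF \<open>a \<in> closure {a<..<b}\<close>] by simp
  then have "integral {a..r} g = v r - v a" by (simp add: H_def algebra_simps)
  moreover have "g integrable_on {a..r}" using r by (intro integrable_on_subinterval[OF g_int]) auto
  ultimately show "(g has_integral (v r - v a)) {a..r}" by (simp add: has_integral_iff)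
qed

lemma W11_primitive_on:
  assumes "a < b" "u \<in> W11 a b"
  shows "primitive_on a b u (weak_deriv a b u)"
proof (rule weak_derivative_primitive)
  show "has_weak_derivative a b u (weak_deriv a b u)"
    using assms(2) someI_ex[of "has_weak_derivative a b u"] by (simp add: W11_def weak_deriv_def)
  show "continuous_on {a..b} u"
    using assms(2) absolutely_continuous_on_Icc_imp_continuous unfolding W11_def by blast
qed fact

lemma primitive_on_W11:
  fixes u :: "real \<Rightarrow> real ^ 'n"
  assumes "a < b" "primitive_on a b u g"
  shows "u \<in> W11 a b" "AE t in lebesgue. t \<in> {a..b} \<longrightarrow> weak_deriv a b u t = g t"
proof -
  show "u \<in> W11 a b"
    using primitive_on_absolutely_continuous[OF assms(2)] primitive_on_weak_derivative[OF assms(2,1)]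
    unfolding W11_def by blast
  from primitive_on_unique[OF W11_primitive_on[OF assms(1) this] assms(2)]
  show "AE t in lebesgue. t \<in> {a..b} \<longrightarrow> weak_deriv a b u t = g t" .
qed

section \<open>Replacing a minimizer by a chord\<close>

lemma primitive_on_cong:
  assumes prim: "primitive_on a b u g"
    and u: "\<And>r. r \<in> {a..b} \<Longrightarrow> u' r = u r" and g: "\<And>r. r \<in> {a<..<b} \<Longrightarrow> g' r = g r"
  shows "primitive_on a b u' g'"
proof (rule primitive_onI)
  have g_off: "g' r = g r" if "r \<in> {a..b} - {a, b}" for r using g[of r] that by auto
  have "g absolutely_integrable_on {a..b}" using prim by (simp add: primitive_on_def)
  then show "g' absolutely_integrable_on {a..b}"
    by (rule absolutely_integrable_spike[where S = "{a, b}"]) (use g_off in auto)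
  fix r assume r: "a \<le> r" "r \<le> b"
  have "(g has_integral (u r - u a)) {a..r}"
    by (rule primitive_onD[OF prim]) (use r in auto)
  then have "(g has_integral (u' r - u' a)) {a..r}"
    using r by (simp add: u)
  then show "(g' has_integral (u' r - u' a)) {a..r}"
    by (rule has_integral_spike_finite[of "{a, b}", rotated 2]) (use r g_off in auto)
qed

lemma primitive_on_subinterval:
  assumes "primitive_on a b u g" "a \<le> c" "d \<le> b"
  shows "primitive_on c d u g"
proof (rule primitive_onI)
  show "g absolutely_integrable_on {c..d}"
    by (rule primitive_on_integrable[OF assms(1)]) (use assms in auto)
  show "(g has_integral (u r - u c)) {c..r}" if "c \<le> r" "r \<le> d" for r
    by (rule primitive_onD[OF assms(1)]) (use assms that in auto)
qed

lemma primitive_on_combine: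
  assumes left: "primitive_on a c u g" and right: "primitive_on c b u g" and c: "a \<le> c" "c \<le> b"
  shows "primitive_on a b u g"
proof (rule primitive_onI)
  show "g absolutely_integrable_on {a..b}"
    by (rule absolutely_integrable_on_combine[where c = c])
      (use left right c in \<open>simp_all add: primitive_on_def\<close>)
  fix r assume r: "a \<le> r" "r \<le> b"
  show "(g has_integral (u r - u a)) {a..r}"
  proof (cases "r \<le> c")
    case True
    then show ?thesis using r by (intro primitive_onD[OF left]) auto
  next
    case False
    have "(g has_integral (u c - u a) + (u r - u c)) {a..r}"
    proof (rule has_integral_combine[of a c r])
      show "(g has_integral (u c - u a)) {a..c}" by (rule primitive_onD[OF left]) (use c in auto)
      show "(g has_integral (u r - u c)) {c..r}" by (rule primitive_onD[OF right]) (use r False in auto)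
    qed (use c False in auto)
    then show ?thesis by simp
  qed
qed

definition slope :: "(real \<Rightarrow> 'b::real_vector) \<Rightarrow> real \<Rightarrow> real \<Rightarrow> 'b"
  where "slope v x y = (v y - v x) /\<^sub>R (y - x)"

definition chord :: "(real \<Rightarrow> 'b::real_vector) \<Rightarrow> real \<Rightarrow> real \<Rightarrow> real \<Rightarrow> 'b"
  where "chord v x y r = v x + (r - x) *\<^sub>R slope v x y"

definition replace_by_chord :: "(real \<Rightarrow> 'b::real_vector) \<Rightarrow> real \<Rightarrow> real \<Rightarrow> real \<Rightarrow> 'b"
  where "replace_by_chord v x y r = (if r \<in> {x..y} then chord v x y r else v r)"

lemma chord_endpoints: "x < y \<Longrightarrow> chord v x y x = v x" "x < y \<Longrightarrow> chord v x y y = v y"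
  by (simp_all add: chord_def slope_def)

lemma primitive_on_chord:
  fixes v :: "real \<Rightarrow> 'b::euclidean_space"
  shows "primitive_on x y (chord v x y) (\<lambda>_. slope v x y)"
proof (rule primitive_onI)
  show "(\<lambda>_. slope v x y) absolutely_integrable_on {x..y}"
    by (rule absolutely_integrable_continuous_real) simp
  fix r assume "x \<le> r" "r \<le> y"
  then show "((\<lambda>_. slope v x y) has_integral (chord v x y r - chord v x y x)) {x..r}"
    using has_integral_const_real[of "slope v x y" x r] by (simp add: chord_def)
qed

lemma primitive_on_replace_by_chord:
  fixes v :: "real \<Rightarrow> 'b::euclidean_space"
  assumes prim: "primitive_on a b v g" and xy: "a \<le> x" "x < y" "y \<le> b"
  shows "primitive_on a b (replace_by_chord v x y) (\<lambda>r. if r \<in> {x<..<y} then slope v x y else g r)"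
    (is "primitive_on a b ?u ?h")
proof -
  have 1: "primitive_on a x ?u ?h"
    by (rule primitive_on_cong[OF primitive_on_subinterval[OF prim, of a x]])
      (use xy chord_endpoints[of x y v] in \<open>auto simp: replace_by_chord_def\<close>)
  have 2: "primitive_on x y ?u ?h"
    by (rule primitive_on_cong[OF primitive_on_chord]) (auto simp: replace_by_chord_def)
  have 3: "primitive_on y b ?u ?h"
    by (rule primitive_on_cong[OF primitive_on_subinterval[OF prim, of y b]])
      (use xy chord_endpoints[of x y v] in \<open>auto simp: replace_by_chord_def\<close>)
  show ?thesis
    by (rule primitive_on_combine[OF primitive_on_combine[OF 1 2] 3]) (use xy in auto)
qed

lemma SC_subgradient:
  assumes "strict_convexity_SC a b L" "t \<in> {a..b}"
  shows "\<exists>\<xi>. is_subgradient (L t y) p \<xi>"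
proof -
  define R where "R = Max {1, \<bar>t\<bar>, norm y, norm p}"
  have "1 \<le> R" "Max {\<bar>t\<bar>, norm y, norm p} \<le> R + 1" by (auto simp: R_def)
  then show ?thesis
    using assms unfolding strict_convexity_SC_def by blast
qed

lemma Lagrangian_measurable:
  fixes L :: "real \<Rightarrow> 'b::euclidean_space \<Rightarrow> 'b \<Rightarrow> real"
  assumes L: "continuous_on ({a..b} \<times> UNIV \<times> UNIV) (\<lambda>(t, y, p). L t y p)"
    and u: "continuous_on {a..b} u" and g: "g absolutely_integrable_on {a..b}"
  shows "(\<lambda>r. L r (u r) (g r)) \<in> borel_measurable (lebesgue_on {a..b})"
proof -
  let ?S = "{a..b} \<times> (UNIV :: ('b \<times> 'b) set)"
  let ?F = "\<lambda>z. if z \<in> ?S then (\<lambda>(t, y, p). L t y p) z else 0"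
  have "closed ?S" by (intro closed_Times) auto
  then have "?F \<in> borel_measurable borel"
    using L by (intro borel_measurable_continuous_on_if) auto
  moreover have "(\<lambda>r. (r, u r, g r)) \<in> borel_measurable (lebesgue_on {a..b})"
  proof (intro borel_measurable_Pair)
    show "(\<lambda>r. r) \<in> borel_measurable (lebesgue_on {a..b})"
      by (rule continuous_imp_measurable_on_sets_lebesgue) (auto intro: continuous_on_id)
    show "u \<in> borel_measurable (lebesgue_on {a..b})"
      using u by (rule continuous_imp_measurable_on_sets_lebesgue) auto
    show "g \<in> borel_measurable (lebesgue_on {a..b})"
      using absolutely_integrable_imp_integrable[OF g] by auto
  qed
  ultimately have "(\<lambda>r. ?F (r, u r, g r)) \<in> borel_measurable (lebesgue_on {a..b})"
    by (rule measurable_compose[rotated])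
  then show ?thesis
    by (rule measurable_cong[THEN iffD1, rotated]) auto
qed

text \<open>A subgradient at velocity 0 bounds \<open>L\<close> from below by an affine function of the velocity. The
slope of that function is bounded uniformly along \<open>u\<close>, because moving one unit in the direction of the
subgradient raises \<open>L\<close> by at least its norm, and \<open>L\<close> is bounded on a compact set.\<close>

lemma Lagrangian_lower_bound:
  fixes L :: "real \<Rightarrow> real ^ 'n \<Rightarrow> real ^ 'n \<Rightarrow> real"
  assumes L: "continuous_on ({a..b} \<times> UNIV \<times> UNIV) (\<lambda>(t, y, p). L t y p)"
    and SC: "strict_convexity_SC a b L" and u: "continuous_on {a..b} u"
  obtains C where "0 \<le> C" "\<And>r q. r \<in> {a..b} \<Longrightarrow> - L r (u r) q \<le> C * (1 + norm q)"
proof -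
  let ?K = "{a..b} \<times> u ` {a..b} \<times> cball 0 1"
  have "compact ((\<lambda>(t, y, p). L t y p) ` ?K)"
    by (intro compact_continuous_image continuous_on_subset[OF L] compact_Times u) auto
  then obtain B where "0 < B" and B: "\<And>z. z \<in> (\<lambda>(t, y, p). L t y p) ` ?K \<Longrightarrow> norm z \<le> B"
    using compact_imp_bounded bounded_pos by metis
  have L_le: "\<bar>L r (u r) q\<bar> \<le> B" if "r \<in> {a..b}" "norm q \<le> 1" for r q
  proof -
    have "(r, u r, q) \<in> ?K" using that by (simp add: mem_cball)
    then have "(\<lambda>(t, y, p). L t y p) (r, u r, q) \<in> (\<lambda>(t, y, p). L t y p) ` ?K" by (rule imageI)
    from B[OF this] show ?thesis by simp
  qed
  have "- L r (u r) q \<le> 2 * B * (1 + norm q)" if r: "r \<in> {a..b}" for r q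
  proof -
    obtain \<xi> where \<xi>: "\<And>q. L r (u r) q \<ge> L r (u r) 0 + \<xi> \<bullet> q"
      using SC_subgradient[OF SC r, of "u r" 0] by (auto simp: is_subgradient_def)
    \<comment> \<open>with the convention \<open>sgn 0 = 0\<close> this also covers a vanishing subgradient\<close>
    have "\<xi> \<bullet> sgn \<xi> = norm \<xi>"
      by (cases "\<xi> = 0") (simp_all add: sgn_div_norm dot_square_norm power2_eq_square)
    moreover have "norm (sgn \<xi>) \<le> 1" by (simp add: norm_sgn)
    ultimately have "norm \<xi> \<le> 2 * B"
      using \<xi>[of "sgn \<xi>"] L_le[OF r, of 0] L_le[OF r, of "sgn \<xi>"] by simp
    then have "\<bar>\<xi> \<bullet> q\<bar> \<le> 2 * B * norm q"
      by (intro order_trans[OF Cauchy_Schwarz_ineq2] mult_right_mono) auto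
    then show ?thesis
      using \<xi>[of q] L_le[OF r, of 0] \<open>0 < B\<close> by (simp add: algebra_simps)
  qed
  then show ?thesis using \<open>0 < B\<close> by (intro that[of "2 * B"]) auto
qed

lemma action_eq_nn_integrals:
  fixes u g :: "real \<Rightarrow> real ^ 'n"
  assumes "a < b" "primitive_on a b u g"
  shows "action L a b u =
    enn2ereal (\<integral>\<^sup>+t. ennreal (indicator {a<..<b} t *\<^sub>R L t (u t) (g t)) \<partial>lebesgue) -
    enn2ereal (\<integral>\<^sup>+t. ennreal (- (indicator {a<..<b} t *\<^sub>R L t (u t) (g t))) \<partial>lebesgue)"
proof -
  note ae = primitive_on_W11(2)[OF assms]
  have "(\<integral>\<^sup>+t\<in>{a<..<b}. ennreal (L t (u t) (weak_deriv a b u t)) \<partial>lebesgue) =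
      (\<integral>\<^sup>+t. ennreal (indicator {a<..<b} t *\<^sub>R L t (u t) (g t)) \<partial>lebesgue)"
    by (rule nn_integral_cong_AE, use ae in eventually_elim) (auto simp: indicator_def)
  moreover have "(\<integral>\<^sup>+t\<in>{a<..<b}. ennreal (- L t (u t) (weak_deriv a b u t)) \<partial>lebesgue) =
      (\<integral>\<^sup>+t. ennreal (- (indicator {a<..<b} t *\<^sub>R L t (u t) (g t))) \<partial>lebesgue)"
    by (rule nn_integral_cong_AE, use ae in eventually_elim) (auto simp: indicator_def)
  ultimately show ?thesis by (simp add: action_def)
qed

lemma action_eq_integral:
  fixes u g :: "real \<Rightarrow> real ^ 'n"
  assumes "a < b" "primitive_on a b u g" and int: "(\<lambda>t. L t (u t) (g t)) absolutely_integrable_on {a..b}"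
  shows "action L a b u = ereal (integral {a..b} (\<lambda>t. L t (u t) (g t)))"
proof -
  define h where "h t = indicator {a<..<b} t *\<^sub>R L t (u t) (g t)" for t
  have h: "integrable lebesgue h"
    using set_integral_open_eq_integral(1)[OF int] unfolding set_integrable_def h_def[abs_def] .
  have "integral\<^sup>L lebesgue h = integral {a..b} (\<lambda>t. L t (u t) (g t))"
    using set_integral_open_eq_integral(2)[OF int] by (simp only: set_lebesgue_integral_def h_def[abs_def])
  moreover have "ereal (integral\<^sup>L lebesgue h) = enn2ereal (\<integral>\<^sup>+t. ennreal (h t) \<partial>lebesgue) -
      enn2ereal (\<integral>\<^sup>+t. ennreal (- h t) \<partial>lebesgue)"
  proof -
    obtain P N where PN: "0 \<le> P" "(\<integral>\<^sup>+t. ennreal (h t) \<partial>lebesgue) = ennreal P"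
      "0 \<le> N" "(\<integral>\<^sup>+t. ennreal (- h t) \<partial>lebesgue) = ennreal N"
      using h unfolding real_integrable_def by (metis ennreal_cases infinity_ennreal_def)
    then show ?thesis
      by (simp add: real_lebesgue_integral_def[OF h] enn2ereal_ennreal)
  qed
  ultimately show ?thesis
    by (simp add: action_eq_nn_integrals[OF assms(1,2)] h_def)
qed

text \<open>The negative part of the integrand is always integrable by \<open>Lagrangian_lower_bound\<close>, so an
action below \<open>\<infinity>\<close> leaves no room for a nonintegrable positive part.\<close>

lemma finite_action_integrable:
  fixes u g :: "real \<Rightarrow> real ^ 'n"
  assumes "a < b" and L: "continuous_on ({a..b} \<times> UNIV \<times> UNIV) (\<lambda>(t, y, p). L t y p)"
    and SC: "strict_convexity_SC a b L" and prim: "primitive_on a b u g"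
    and finite: "action L a b u < \<infinity>"
  shows "(\<lambda>t. L t (u t) (g t)) absolutely_integrable_on {a..b}"
proof -
  have g: "g absolutely_integrable_on {a..b}" using prim by (simp add: primitive_on_def)
  have u: "continuous_on {a..b} u" by (rule primitive_on_continuous[OF prim])
  define h where "h t = indicator {a<..<b} t *\<^sub>R L t (u t) (g t)" for t
  obtain C where "0 \<le> C" and C: "\<And>r q. r \<in> {a..b} \<Longrightarrow> - L r (u r) q \<le> C * (1 + norm q)"
    using Lagrangian_lower_bound[OF L SC u] by blast
  have "(\<lambda>t. L t (u t) (g t)) \<in> borel_measurable (lebesgue_on {a<..<b})"
    by (rule measurable_restrict_mono[OF Lagrangian_measurable[OF L u g]]) auto
  then have h_meas: "h \<in> borel_measurable lebesgue"
    unfolding h_def by (subst (asm) borel_measurable_restrict_space_iff) auto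
  have "(\<lambda>t. C * (1 + norm (g t))) absolutely_integrable_on {a..b}"
    by (intro set_integrable_mult_right set_integral_add(1) absolutely_integrable_norm[OF g, unfolded o_def]) auto
  then have "integrable lebesgue (\<lambda>t. indicator {a<..<b} t *\<^sub>R (C * (1 + norm (g t))))"
    unfolding set_integrable_def[symmetric] by (rule set_integral_open_eq_integral(1))
  then have "(\<integral>\<^sup>+t. ennreal (indicator {a<..<b} t *\<^sub>R (C * (1 + norm (g t)))) \<partial>lebesgue) < \<infinity>"
    by (auto simp: real_integrable_def less_top)
  moreover have "(\<integral>\<^sup>+t. ennreal (- h t) \<partial>lebesgue) \<le>
      (\<integral>\<^sup>+t. ennreal (indicator {a<..<b} t *\<^sub>R (C * (1 + norm (g t)))) \<partial>lebesgue)"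
    using C by (intro nn_integral_mono ennreal_leI) (auto simp: h_def indicator_def)
  ultimately have neg: "(\<integral>\<^sup>+t. ennreal (- h t) \<partial>lebesgue) < \<infinity>" by (rule le_less_trans[rotated])
  then obtain N where N: "0 \<le> N" "(\<integral>\<^sup>+t. ennreal (- h t) \<partial>lebesgue) = ennreal N"
    by (metis ennreal_cases infinity_ennreal_def less_irrefl)
  have "(\<integral>\<^sup>+t. ennreal (h t) \<partial>lebesgue) \<noteq> \<infinity>"
  proof
    assume "(\<integral>\<^sup>+t. ennreal (h t) \<partial>lebesgue) = \<infinity>"
    then have "action L a b u = \<infinity>"
      unfolding action_eq_nn_integrals[OF \<open>a < b\<close> prim] h_def[symmetric]
      using N by (simp add: enn2ereal_ennreal)
    with finite show False by simp
  qed
  then have "integrable lebesgue h"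
    using h_meas neg by (auto simp: real_integrable_def)
  then have "(\<lambda>t. L t (u t) (g t)) absolutely_integrable_on {a<..<b}"
    unfolding set_integrable_def h_def[abs_def] .
  then show ?thesis by (simp only: absolutely_integrable_on_Icc_iff_Ioo)
qed

lemma continuous_on_Lagrangian_chord:
  fixes v :: "real \<Rightarrow> real ^ 'n"
  assumes L: "continuous_on ({a..b} \<times> UNIV \<times> UNIV) (\<lambda>(t, y, p). L t y p)" and xy: "a \<le> x" "y \<le> b"
  shows "continuous_on {x..y} (\<lambda>r. L r (chord v x y r) (slope v x y))"
proof -
  have "continuous_on {x..y} (\<lambda>r. (r, chord v x y r, slope v x y))"
    unfolding chord_def by (intro continuous_intros)
  moreover have "(\<lambda>r. (r, chord v x y r, slope v x y)) ` {x..y} \<subseteq> {a..b} \<times> UNIV \<times> UNIV"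
    using xy by auto
  ultimately show ?thesis
    using continuous_on_compose2[OF L] by fastforce
qed

text \<open>The minimizer and its modification have the same integrand outside \<open>{x..y}\<close>. Those contributions may be
cancelled because they are finite: the chord over all of \<open>{a..b}\<close> is a competitor of finite action, so
the minimizer has finite action too.\<close>

lemma minimizer_beats_chord:
  fixes v g :: "real \<Rightarrow> real ^ 'n"
  assumes "a < b" and L: "continuous_on ({a..b} \<times> UNIV \<times> UNIV) (\<lambda>(t, y, p). L t y p)"
    and SC: "strict_convexity_SC a b L" and min: "is_minimizer L a b v" and prim: "primitive_on a b v g"
    and xy: "a \<le> x" "x < y" "y \<le> b"
  shows "(\<lambda>r. L r (v r) (g r)) integrable_on {x..y}"
    and "integral {x..y} (\<lambda>r. L r (v r) (g r)) \<le> integral {x..y} (\<lambda>r. L r (chord v x y r) (slope v x y))"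
proof -
  let ?h = "\<lambda>x y r. if r \<in> {x<..<y} then slope v x y else g r"
  have le: "action L a b v \<le> action L a b (replace_by_chord v x y)" if "a \<le> x" "x < y" "y \<le> b" for x y
  proof -
    have "replace_by_chord v x y \<in> W11_bc a b (v a) (v b)"
      using primitive_on_W11(1)[OF \<open>a < b\<close> primitive_on_replace_by_chord[OF prim that]]
        chord_endpoints[OF \<open>x < y\<close>, of v] that
      by (auto simp: W11_bc_def replace_by_chord_def)
    with min show ?thesis by (simp add: is_minimizer_def)
  qed
  have pieces: "((\<lambda>r. L r (replace_by_chord v x y r) (?h x y r)) has_integral
      integral {x..y} (\<lambda>r. L r (chord v x y r) (slope v x y))) {x..y}"
    if "a \<le> x" "y \<le> b" for x y
    by (rule has_integral_spike_finite[of "{x, y}", OF _ _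
          integrable_integral[OF integrable_continuous_real[OF continuous_on_Lagrangian_chord[OF L that]]]])
      (auto simp: replace_by_chord_def)
  have abs_pieces: "(\<lambda>r. L r (replace_by_chord v x y r) (?h x y r)) absolutely_integrable_on {x..y}"
    if "a \<le> x" "y \<le> b" for x y
    by (rule absolutely_integrable_spike[where S = "{x, y}",
          OF absolutely_integrable_continuous_real[OF continuous_on_Lagrangian_chord[OF L that]]])
      (auto simp: replace_by_chord_def)
  \<comment> \<open>along a single chord the integrand is continuous\<close>
  have "action L a b (replace_by_chord v a b) < \<infinity>"
    using action_eq_integral[where L = L, OF \<open>a < b\<close> primitive_on_replace_by_chord[OF prim order_refl \<open>a < b\<close> order_refl]
        abs_pieces[OF order_refl order_refl]] by simp
  then have fin: "action L a b v < \<infinity>"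
    using le[OF order_refl \<open>a < b\<close> order_refl] by (rule le_less_trans[rotated])
  have abs_v: "(\<lambda>r. L r (v r) (g r)) absolutely_integrable_on {a..b}"
    by (rule finite_action_integrable[OF \<open>a < b\<close> L SC prim fin])
  note int_v = set_lebesgue_integral_eq_integral(1)[OF abs_v]
  have sub: "(\<lambda>r. L r (v r) (g r)) integrable_on {c..d}" if "a \<le> c" "d \<le> b" for c d
    by (rule integrable_on_subinterval[OF int_v]) (use that in auto)
  show "(\<lambda>r. L r (v r) (g r)) integrable_on {x..y}"
    by (rule sub[OF xy(1,3)])
  let ?l = "\<lambda>r. L r (replace_by_chord v x y r) (?h x y r)"
  have left: "(?l has_integral integral {a..x} (\<lambda>r. L r (v r) (g r))) {a..x}"
    by (rule has_integral_spike_finite[of "{x}", OF _ _ integrable_integral[OF sub]])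
      (use xy in \<open>auto simp: replace_by_chord_def\<close>)
  have right: "(?l has_integral integral {y..b} (\<lambda>r. L r (v r) (g r))) {y..b}"
    by (rule has_integral_spike_finite[of "{y}", OF _ _ integrable_integral[OF sub]])
      (use xy in \<open>auto simp: replace_by_chord_def\<close>)
  have total: "(?l has_integral integral {a..x} (\<lambda>r. L r (v r) (g r)) +
      integral {x..y} (\<lambda>r. L r (chord v x y r) (slope v x y)) + integral {y..b} (\<lambda>r. L r (v r) (g r))) {a..b}"
    using xy by (intro has_integral_combine[of a y b, OF _ _ has_integral_combine[of a x y, OF _ _ left pieces] right]) auto
  have "?l absolutely_integrable_on {a..b}"
  proof -
    have outer: "?l absolutely_integrable_on {c..d}" if "{c..d} \<subseteq> {a..b}" "d \<le> x \<or> y \<le> c" for c d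
    proof (rule absolutely_integrable_spike[where S = "{x, y}"])
      show "(\<lambda>r. L r (v r) (g r)) absolutely_integrable_on {c..d}"
        by (rule set_integrable_subset[OF abs_v]) (use that in auto)
    qed (use xy that in \<open>auto simp: replace_by_chord_def\<close>)
    have "?l absolutely_integrable_on {a..y}"
      by (rule absolutely_integrable_on_combine[OF outer abs_pieces[OF xy(1,3)]]) (use xy in auto)
    then show ?thesis
      by (rule absolutely_integrable_on_combine[OF _ outer]) (use xy in auto)
  qed
  from action_eq_integral[where L = L, OF \<open>a < b\<close> primitive_on_replace_by_chord[OF prim xy] this]
  have "integral {a..b} (\<lambda>r. L r (v r) (g r)) \<le> integral {a..b} ?l"
    using le[OF xy] action_eq_integral[where L = L, OF \<open>a < b\<close> prim abs_v] by simp
  moreover have "integral {a..b} (\<lambda>r. L r (v r) (g r)) = integral {a..x} (\<lambda>r. L r (v r) (g r)) +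
      integral {x..y} (\<lambda>r. L r (v r) (g r)) + integral {y..b} (\<lambda>r. L r (v r) (g r))"
    using Henstock_Kurzweil_Integration.integral_combine[OF _ _ sub, of a y b]
      Henstock_Kurzweil_Integration.integral_combine[OF _ _ sub, of a x y] xy
    by simp
  ultimately show "integral {x..y} (\<lambda>r. L r (v r) (g r)) \<le> integral {x..y} (\<lambda>r. L r (chord v x y r) (slope v x y))"
    using integral_unique[OF total] by simp
qed

section \<open>Covering the slow set by chords of fixed slope\<close>

lemma lmeasurable_sublevel:
  fixes G :: "real \<Rightarrow> real"
  assumes "G absolutely_integrable_on {p..q}" "p \<le> c" "d \<le> q"
  shows "{r \<in> {c<..<d}. G r \<le> m} \<in> lmeasurable"
proof (rule bounded_set_imp_lmeasurable)
  have "G \<in> borel_measurable (lebesgue_on {p..q})"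
    using absolutely_integrable_imp_integrable[OF assms(1)] by auto
  then have "G \<in> borel_measurable (lebesgue_on {c<..<d})"
    by (rule measurable_restrict_mono) (use assms in auto)
  then have "{r \<in> space (lebesgue_on {c<..<d}). G r \<le> m} \<in> sets (lebesgue_on {c<..<d})"
    by measurable
  then show "{r \<in> {c<..<d}. G r \<le> m} \<in> sets lebesgue"
    by (subst (asm) sets_restrict_space_iff) auto
  show "bounded {r \<in> {c<..<d}. G r \<le> m}"
    by (rule bounded_subset[of "{c..d}"]) auto
qed

lemma has_integral_mult_indicator:
  fixes \<eta> :: real
  assumes "A \<in> lmeasurable" "A \<subseteq> {c..d}"
  shows "((\<lambda>r. \<eta> * indicator A r) has_integral \<eta> * measure lebesgue A) {c..d}"
proof -
  have "(indicator A has_integral measure lebesgue A) UNIV"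
    using assms(1) by (simp add: lmeasurable_iff_has_integral)
  then have "((\<lambda>r. \<eta> * indicator A r) has_integral \<eta> * measure lebesgue A) UNIV"
    by (rule has_integral_mult_right)
  moreover have "(\<lambda>r. \<eta> * indicator A r) = (\<lambda>r. if r \<in> {c..d} then \<eta> * indicator A r else 0)"
    using assms(2) by (auto simp: fun_eq_iff indicator_def)
  ultimately have "((\<lambda>r. if r \<in> {c..d} then \<eta> * indicator A r else 0) has_integral \<eta> * measure lebesgue A) UNIV"
    by simp
  then show ?thesis by (simp only: has_integral_restrict_UNIV)
qed

lemma measure_mult_le_integral:
  fixes h :: "real \<Rightarrow> real"
  assumes A: "A \<in> lmeasurable" "A \<subseteq> {c..d}" and h: "h integrable_on {c..d}"
    and nonneg: "\<And>r. r \<in> {c..d} \<Longrightarrow> 0 \<le> h r" and ge: "\<And>r. r \<in> A \<Longrightarrow> \<eta> \<le> h r"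
  shows "\<eta> * measure lebesgue A \<le> integral {c..d} h"
  by (rule has_integral_le[OF has_integral_mult_indicator[OF A] integrable_integral[OF h]])
    (use nonneg ge in \<open>auto simp: indicator_def\<close>)

text \<open>The covering argument. Here \<open>G\<close> is the speed of \<open>w\<close>; \<open>steep\<close> says that chords issuing
from \<open>p\<close> have slope greater than \<open>M\<close>, and \<open>sparse\<close> bounds the share of the slow set under chords of slope
exactly \<open>M\<close>. Divide \<open>{p..q}\<close> into equal steps that are short enough for a continuous
\<open>L\<^sup>1\<close>-approximation \<open>k\<close> of \<open>G\<close> to be nearly constant on each. On a step across which \<open>w\<close> moves
faster than \<open>M\<close>, a slow point can only exist at the expense of the error \<open>\<bar>G - k\<bar>\<close>, so such steps
contain little of the slow set. From the right end of any other step a chord of slope \<open>M\<close> leads back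
to some \<open>y\<close>; rounding \<open>y\<close> up to the next division point at most doubles the length that has to be paid for,
and the estimate proceeds by induction from there.\<close>

lemma sublevel_measure_bound:
  fixes w :: "real \<Rightarrow> 'b::real_normed_vector" and G :: "real \<Rightarrow> real"
  assumes pq: "p < q" and w: "continuous_on {p..q} w" and G: "G absolutely_integrable_on {p..q}"
    and speed: "\<And>x y. p \<le> x \<Longrightarrow> x \<le> y \<Longrightarrow> y \<le> q \<Longrightarrow> norm (w y - w x) \<le> integral {x..y} G"
    and "m < M"
    and steep: "\<And>x. p < x \<Longrightarrow> x \<le> q \<Longrightarrow> M * (x - p) < norm (w x - w p)"
    and sparse: "\<And>y x. p < y \<Longrightarrow> y < x \<Longrightarrow> x \<le> q \<Longrightarrow> norm (w x - w y) = M * (x - y) \<Longrightarrow>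
      measure lebesgue {r \<in> {y<..<x}. G r \<le> m} \<le> c * (x - y)"
    and "0 \<le> c"
  shows "measure lebesgue {r \<in> {p<..<q}. G r \<le> m} \<le> 2 * c * (q - p)"
proof (rule field_le_epsilon)
  fix \<epsilon> :: real assume "0 < \<epsilon>"
  \<comment> \<open>a fast step with a slow point where \<open>\<bar>G - k\<bar> < \<eta>\<close> has \<open>k \<le> m + 2 * \<eta>\<close> throughout, which leaves a gap of \<open>\<eta>\<close> below \<open>M\<close>\<close>
  define \<eta> where "\<eta> = (M - m) / 3"
  have "0 < \<eta>" using \<open>m < M\<close> by (simp add: \<eta>_def)
  define E where "E x y = {r \<in> {x<..<y}. G r \<le> m}" for x y
  define \<mu> where "\<mu> x y = measure lebesgue (E x y)" for x y
  have E_meas: "E x y \<in> lmeasurable" if "p \<le> x" "y \<le> q" for x y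
    unfolding E_def by (rule lmeasurable_sublevel[OF G that])
  have \<mu>_add: "\<mu> p y \<le> \<mu> p x + \<mu> x y" if "p \<le> x" "x \<le> y" "y \<le> q" for x y
  proof -
    have E: "E p x \<in> lmeasurable" "E x y \<in> lmeasurable" "E p y \<in> lmeasurable"
      using that by (auto intro!: E_meas)
    then have "E p x \<union> E x y \<union> {x} \<in> lmeasurable"
      using lmeasurable_cbox[of x x] by (intro fmeasurable.Un) auto
    then have "\<mu> p y \<le> measure lebesgue (E p x \<union> E x y \<union> {x})"
      unfolding \<mu>_def using E by (intro measure_mono_fmeasurable) (auto simp: E_def fmeasurableD)
    also have "\<dots> \<le> measure lebesgue (E p x \<union> E x y) + measure lebesgue {x}"
      using E by (intro measure_Un_le) (auto simp: fmeasurableD)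
    also have "\<dots> \<le> \<mu> p x + \<mu> x y"
      using E measure_Un_le[of "E p x" lebesgue "E x y"] by (auto simp: \<mu>_def fmeasurableD)
    finally show ?thesis .
  qed
  obtain k where k: "continuous_on UNIV k" "integral {p..q} (\<lambda>r. norm (G r - k r)) < \<epsilon> * \<eta>"
    using L1_approx_continuous[OF G, of "\<epsilon> * \<eta>"] \<open>0 < \<epsilon>\<close> \<open>0 < \<eta>\<close> by auto
  define h where "h r = \<bar>G r - k r\<bar>" for r
  have "(\<lambda>r. G r - k r) absolutely_integrable_on {p..q}"
    by (intro set_integral_diff(1)[OF G] absolutely_integrable_continuous_real continuous_on_subset[OF k(1)]) simp
  then have h_int: "h integrable_on {p..q}"
    unfolding absolutely_integrable_on_def h_def by simp
  have h_sub: "h integrable_on {x..y}" if "p \<le> x" "y \<le> q" for x y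
    by (rule integrable_on_subinterval[OF h_int]) (use that in auto)
  have G_sub: "G integrable_on {x..y}" if "p \<le> x" "y \<le> q" for x y
    by (rule integrable_on_subinterval[OF set_lebesgue_integral_eq_integral(1)[OF G]]) (use that in auto)
  have "uniformly_continuous_on {p..q} k"
    by (rule compact_uniformly_continuous[OF continuous_on_subset[OF k(1)]]) auto
  then obtain \<delta> where "0 < \<delta>"
    and \<delta>: "\<And>x y. x \<in> {p..q} \<Longrightarrow> y \<in> {p..q} \<Longrightarrow> \<bar>x - y\<bar> < \<delta> \<Longrightarrow> \<bar>k x - k y\<bar> < \<eta>"
    using \<open>0 < \<eta>\<close> unfolding uniformly_continuous_on_def dist_real_def by metis
  obtain N where N: "max 1 ((q - p) / \<delta>) < real N" using reals_Archimedean2 by blast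
  then have "0 < N" and "(q - p) / \<delta> < real N" by (auto intro: gr0I)
  define d where "d = (q - p) / real N"
  have "0 < d" using pq \<open>0 < N\<close> by (simp add: d_def)
  have "d < \<delta>" using \<open>(q - p) / \<delta> < real N\<close> \<open>0 < N\<close> \<open>0 < \<delta>\<close> by (simp add: d_def field_simps)
  define x where "x j = p + real j * d" for j :: nat
  have x_Suc: "x (Suc j) = x j + d" for j by (simp add: x_def algebra_simps)
  have x_0: "x 0 = p" and x_N: "x N = q" using \<open>0 < N\<close> by (auto simp: x_def d_def)
  have x_mono: "x i \<le> x j" if "i \<le> j" for i j
    using that \<open>0 < d\<close> by (simp add: x_def mult_right_mono)
  have x_ge: "p \<le> x j" for j using x_mono[of 0 j] x_0 by simp
  have x_le: "x j \<le> q" if "j \<le> N" for j using x_mono[OF that] x_N by simp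
  have bad: "\<mu> (x j) (x (Suc j)) \<le> integral {x j..x (Suc j)} h / \<eta>"
    if "Suc j \<le> N" and fast: "M * d < norm (w (x (Suc j)) - w (x j))" for j
  proof -
    let ?J = "{x j..x (Suc j)}"
    have J: "p \<le> x j" "x (Suc j) \<le> q" "x j \<le> x (Suc j)"
      using that(1) x_ge x_le x_mono[of j "Suc j"] by auto
    note hJ = h_sub[OF J(1,2)]
    have h_nonneg: "0 \<le> h r" for r by (simp add: h_def)
    have "\<eta> * \<mu> (x j) (x (Suc j)) \<le> integral ?J h"
    proof (cases "\<exists>r\<in>E (x j) (x (Suc j)). h r < \<eta>")
      case True
      then obtain r where "r \<in> E (x j) (x (Suc j))" "h r < \<eta>" by blast
      then have r: "r \<in> ?J" "G r \<le> m" "h r < \<eta>" by (auto simp: E_def)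
      have "G s \<le> h s + (m + 2 * \<eta>)" if "s \<in> ?J" for s
      proof -
        have "\<bar>s - r\<bar> \<le> d" using that r(1) by (auto simp: x_Suc abs_le_iff)
        then have "\<bar>k s - k r\<bar> < \<eta>"
          using that r(1) J \<open>d < \<delta>\<close> by (intro \<delta>) auto
        with r(2,3) show ?thesis by (simp add: h_def)
      qed
      then have "integral ?J G \<le> integral ?J (\<lambda>s. h s + (m + 2 * \<eta>))"
        by (intro integral_le integrable_add hJ G_sub J(1,2) integrable_const_ivl) auto
      also have "\<dots> = integral ?J h + (m + 2 * \<eta>) * d"
        using integral_add[OF hJ integrable_const_ivl, of "m + 2 * \<eta>"] \<open>0 < d\<close> by (simp add: x_Suc)
      finally have "M * d < integral ?J h + (m + 2 * \<eta>) * d"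
        using fast speed[OF J(1,3,2)] by linarith
      moreover have "M * d - (m + 2 * \<eta>) * d = \<eta> * d"
        by (simp add: \<eta>_def field_simps)
      ultimately have "\<eta> * d \<le> integral ?J h" by linarith
      moreover have "\<mu> (x j) (x (Suc j)) \<le> d"
      proof -
        have "\<mu> (x j) (x (Suc j)) \<le> measure lebesgue {x j..x (Suc j)}"
          unfolding \<mu>_def by (rule measure_mono_fmeasurable) (use E_meas J in \<open>auto simp: E_def fmeasurableD\<close>)
        then show ?thesis using \<open>0 < d\<close> by (simp add: x_Suc)
      qed
      ultimately show ?thesis
        using mult_left_mono[of "\<mu> (x j) (x (Suc j))" d \<eta>] \<open>0 < \<eta>\<close> by linarith
    next
      case False
      then show ?thesis
        unfolding \<mu>_def using J hJ h_nonneg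
        by (intro measure_mult_le_integral E_meas) (auto simp: E_def not_less)
    qed
    then show ?thesis using \<open>0 < \<eta>\<close> by (simp add: field_simps)
  qed
  \<comment> \<open>the first term pays for the chords, the second for the fast steps\<close>
  have "\<mu> p (x j) \<le> 2 * c * (x j - p) + integral {p..x j} h / \<eta>" if "j \<le> N" for j
    using that
  proof (induction j rule: less_induct)
    case (less j)
    show ?case
    proof (cases j)
      case 0
      then show ?thesis by (simp add: x_0 \<mu>_def E_def)
    next
      case (Suc i)
      note bounds = x_ge[of i] x_le[of j] x_mono[of i j] Suc less.prems
      have h_mono: "integral {p..x l} h \<le> integral {p..x j} h" if "l \<le> j" for l
        using that less.prems x_mono[OF that] x_le
        by (intro integral_subset_le h_sub) (auto simp: h_def intro: order_trans)
      show ?thesis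
      proof (cases "norm (w (x j) - w (x i)) \<le> M * d")
        case False
        have "\<mu> p (x j) \<le> \<mu> p (x i) + \<mu> (x i) (x j)"
          using bounds by (intro \<mu>_add) auto
        also have "\<dots> \<le> (2 * c * (x i - p) + integral {p..x i} h / \<eta>) + integral {x i..x j} h / \<eta>"
          using less.IH[of i] bad[of i] False bounds by (intro add_mono) auto
        also have "\<dots> = 2 * c * (x i - p) + (integral {p..x i} h + integral {x i..x j} h) / \<eta>"
          by (simp add: add_divide_distrib)
        also have "integral {p..x i} h + integral {x i..x j} h = integral {p..x j} h"
          using bounds by (intro Henstock_Kurzweil_Integration.integral_combine h_sub) auto
        also have "2 * c * (x i - p) \<le> 2 * c * (x j - p)"
          using bounds \<open>0 \<le> c\<close> by (intro mult_left_mono) auto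
        finally show ?thesis by simp
      next
        case True
        \<comment> \<open>a zero of \<open>f\<close> is the far end of a chord of slope \<open>M\<close>; it exists since the chord to \<open>x i\<close> has slope at most \<open>M\<close> and the chord to \<open>p\<close> is steeper\<close>
        define f where "f y = norm (w (x j) - w y) - M * (x j - y)" for y
        have "continuous_on {p..x i} f"
          unfolding f_def using bounds by (intro continuous_intros continuous_on_subset[OF w]) auto
        moreover have "f (x i) \<le> 0" using True Suc x_Suc[of i] by (simp add: f_def)
        moreover have "0 < f p"
          using steep[of "x j"] bounds x_Suc[of i] \<open>0 < d\<close> by (simp add: f_def)
        ultimately obtain y where y: "p \<le> y" "y \<le> x i" "f y = 0"
          using IVT2'[of f "x i" 0 p] x_ge[of i] by auto
        then have "p < y" using \<open>0 < f p\<close> by (cases "y = p") auto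
        \<comment> \<open>the induction continues from the first division point to the right of \<open>y\<close>, which is at most one step away\<close>
        define l where "l = (LEAST l. y \<le> x l)"
        have l: "y \<le> x l" "l \<le> i"
          unfolding l_def using y(2) by (auto intro: LeastI Least_le)
        have "l \<noteq> 0" using l(1) \<open>p < y\<close> x_0 by (intro notI) simp
        then obtain l' where l': "l = Suc l'" by (cases l) auto
        have "x l' < y"
          using not_less_Least[of l' "\<lambda>l. y \<le> x l"] l' unfolding l_def by simp
        have lj: "x l \<le> x i" "x i < x j" "x j \<le> q" "l < j" "l \<le> N"
          using l(2) x_mono[OF l(2)] bounds x_Suc[of i] \<open>0 < d\<close> by auto
        have "x j - y \<le> 2 * (x j - x l)"
        proof -
          have "x j - x l \<ge> d" using lj(1) Suc x_Suc[of i] by simp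
          with \<open>x l' < y\<close> l' x_Suc[of l'] show ?thesis by simp
        qed
        have "\<mu> p (x j) \<le> \<mu> p (x l) + \<mu> y (x j)"
        proof -
          have "\<mu> (x l) (x j) \<le> \<mu> y (x j)"
            unfolding \<mu>_def
            by (rule measure_mono_fmeasurable)
              (use l lj E_meas[of "x l" "x j"] E_meas[of y "x j"] y x_ge in \<open>auto simp: E_def fmeasurableD\<close>)
          moreover have "\<mu> p (x j) \<le> \<mu> p (x l) + \<mu> (x l) (x j)"
            using lj x_ge by (intro \<mu>_add) auto
          ultimately show ?thesis by simp
        qed
        also have "\<mu> y (x j) \<le> c * (x j - y)"
          unfolding \<mu>_def E_def
          by (rule sparse) (use \<open>p < y\<close> y lj in \<open>auto simp: f_def\<close>)
        also have "c * (x j - y) \<le> c * (2 * (x j - x l))"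
          using \<open>x j - y \<le> 2 * (x j - x l)\<close> \<open>0 \<le> c\<close> by (rule mult_left_mono)
        also have "\<mu> p (x l) \<le> 2 * c * (x l - p) + integral {p..x l} h / \<eta>"
          by (rule less.IH) (use lj in auto)
        also have "integral {p..x l} h / \<eta> \<le> integral {p..x j} h / \<eta>"
          using h_mono[of l] lj \<open>0 < \<eta>\<close> by (intro divide_right_mono) auto
        finally show ?thesis by (simp add: algebra_simps)
      qed
    qed
  qed
  from this[of N] have "\<mu> p q \<le> 2 * c * (q - p) + integral {p..q} h / \<eta>"
    by (simp add: x_N)
  moreover have "integral {p..q} h / \<eta> \<le> \<epsilon>"
    using k(2) \<open>0 < \<eta>\<close> by (simp add: h_def[abs_def] divide_le_eq)
  ultimately show "measure lebesgue {r \<in> {p<..<q}. G r \<le> m} \<le> 2 * c * (q - p) + \<epsilon>"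
    by (simp add: \<mu>_def E_def)
qed

lemma measure_lebesgue_uminus_image:
  fixes S :: "real set"
  shows "measure lebesgue (uminus ` S) = measure lebesgue S"
  using measure_lebesgue_affine[of "-1" 0 S] by simp

lemma sublevel_measure_bound_left:
  fixes w :: "real \<Rightarrow> 'b::real_normed_vector" and G :: "real \<Rightarrow> real"
  assumes pq: "p < q" and w: "continuous_on {p..q} w" and G: "G absolutely_integrable_on {p..q}"
    and speed: "\<And>x y. p \<le> x \<Longrightarrow> x \<le> y \<Longrightarrow> y \<le> q \<Longrightarrow> norm (w y - w x) \<le> integral {x..y} G"
    and "m < M"
    and steep: "\<And>x. p \<le> x \<Longrightarrow> x < q \<Longrightarrow> M * (q - x) < norm (w x - w q)"
    and sparse: "\<And>y x. p \<le> y \<Longrightarrow> y < x \<Longrightarrow> x < q \<Longrightarrow> norm (w x - w y) = M * (x - y) \<Longrightarrow>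
      measure lebesgue {r \<in> {y<..<x}. G r \<le> m} \<le> c * (x - y)"
    and "0 \<le> c"
  shows "measure lebesgue {r \<in> {p<..<q}. G r \<le> m} \<le> 2 * c * (q - p)"
proof -
  have refl: "measure lebesgue {r \<in> {- x<..<- y}. G (- r) \<le> m} = measure lebesgue {r \<in> {y<..<x}. G r \<le> m}"
    for x y
  proof -
    have "{r \<in> {- x<..<- y}. G (- r) \<le> m} = uminus ` {r \<in> {y<..<x}. G r \<le> m}"
      by (force simp: image_iff intro: exI[of _ "- _"])
    then show ?thesis by (simp add: measure_lebesgue_uminus_image)
  qed
  have "measure lebesgue {r \<in> {- q<..<- p}. G (- r) \<le> m} \<le> 2 * c * (- p - (- q))"
  proof (rule sublevel_measure_bound[where w = "\<lambda>r. w (- r)" and M = M])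
    show "continuous_on {- q..- p} (\<lambda>r. w (- r))"
      by (rule continuous_on_compose2[OF w]) (auto intro!: continuous_intros)
    show "(\<lambda>r. G (- r)) absolutely_integrable_on {- q..- p}"
      using G by simp
    show "norm (w (- y) - w (- x)) \<le> integral {x..y} (\<lambda>r. G (- r))" if "- q \<le> x" "x \<le> y" "y \<le> - p" for x y
    proof -
      have "p \<le> - y" "- y \<le> - x" "- x \<le> q" using that by linarith+
      from speed[OF this] show ?thesis
        using Henstock_Kurzweil_Integration.integral_reflect_real[of "- x" "- y" G]
        by (simp add: norm_minus_commute)
    qed
    show "M * (x - (- q)) < norm (w (- x) - w (- (- q)))" if "- q < x" "x \<le> - p" for x
    proof -
      have "p \<le> - x" "- x < q" using that by linarith+
      from steep[OF this] show ?thesis by (simp add: add.commute)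
    qed
    show "measure lebesgue {r \<in> {y<..<x}. G (- r) \<le> m} \<le> c * (x - y)"
      if "- q < y" "y < x" "x \<le> - p" "norm (w (- x) - w (- y)) = M * (x - y)" for y x
    proof -
      have "p \<le> - x" "- x < - y" "- y < q" using that by linarith+
      moreover have "norm (w (- y) - w (- x)) = M * (- y - (- x))"
        using that(4) by (simp add: norm_minus_commute)
      ultimately have "measure lebesgue {r \<in> {- x<..<- y}. G r \<le> m} \<le> c * (- y - (- x))"
        by (rule sparse)
      then show ?thesis using refl[of "- y" "- x"] unfolding minus_minus by simp
    qed
  qed (use assms in auto)
  then show ?thesis unfolding refl by simp
qed

section \<open>Sparseness of the slow set under chords of fixed slope\<close>

text \<open>One subgradient \<open>\<xi>\<close> at the fixed point \<open>(t0, y0)\<close> serves for all nearby \<open>(t, y)\<close>, up to \<open>\<epsilon>\<close>. Within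
distance 1 of \<open>p\<close> this is uniform continuity of \<open>L\<close> on a compact set. On the unit sphere around \<open>p\<close> the gain
of (SC) survives the perturbation, and along the ray from \<open>p\<close> through a point of that sphere the gap between
the convex function \<open>L t y\<close> and the affine function with slope \<open>\<xi>\<close> continues to grow at least linearly. So the
bound persists at all velocities, where continuity alone says nothing.\<close>

lemma uniform_strict_support:
  fixes L :: "real \<Rightarrow> real ^ 'n \<Rightarrow> real ^ 'n \<Rightarrow> real"
  assumes L: "continuous_on ({a..b} \<times> UNIV \<times> UNIV) (\<lambda>(t, y, p). L t y p)"
    and SC: "strict_convexity_SC a b L" and t0: "t0 \<in> {a..b}"
  obtains \<tau> where "0 < \<tau>" and "\<And>\<epsilon>. 0 < \<epsilon> \<Longrightarrow> \<epsilon> \<le> \<tau> / 2 \<Longrightarrow>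
    \<exists>\<delta>>0. \<forall>p. norm p = M \<longrightarrow> (\<exists>\<xi>. \<forall>t\<in>{a..b}. \<forall>y. \<bar>t - t0\<bar> < \<delta> \<longrightarrow> dist y0 y < \<delta> \<longrightarrow>
      L t y p \<le> L t0 y0 p + \<epsilon> \<and>
      (\<forall>q. L t0 y0 p - \<epsilon> + \<xi> \<bullet> (q - p) + (if 1 \<le> norm (q - p) then \<tau> else 0) \<le> L t y q))"
proof -
  define R where "R = Max {1, \<bar>t0\<bar>, norm y0, M}"
  have R: "1 \<le> R" "\<bar>t0\<bar> \<le> R" "norm y0 \<le> R" "M \<le> R" by (auto simp: R_def)
  then obtain \<tau> where "0 < \<tau>" and \<tau>: "\<forall>t\<in>{a..b}. \<forall>y p. Max {\<bar>t\<bar>, norm y, norm p} \<le> R + 1 \<longrightarrow>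
       (\<exists>\<xi>. is_subgradient (L t y) p \<xi> \<and>
            (\<forall>q. norm (q - p) \<ge> inverse R \<longrightarrow> L t y q \<ge> L t y p + \<xi> \<bullet> (q - p) + 2 * \<tau>))"
    using SC unfolding strict_convexity_SC_def by blast
  show ?thesis
  proof (rule that[OF \<open>0 < \<tau>\<close>])
    fix \<epsilon> :: real assume \<epsilon>: "0 < \<epsilon>" "\<epsilon> \<le> \<tau> / 2"
    let ?K = "{a..b} \<times> cball y0 1 \<times> cball (0 :: real ^ 'n) (M + 1)"
    have "uniformly_continuous_on ?K (\<lambda>(t, y, p). L t y p)"
      by (intro compact_uniformly_continuous continuous_on_subset[OF L] compact_Times) auto
    then obtain \<delta>' where "0 < \<delta>'" and \<delta>': "\<And>z z'. z \<in> ?K \<Longrightarrow> z' \<in> ?K \<Longrightarrow> dist z' z < \<delta>' \<Longrightarrow>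
        dist (case z' of (t, y, p) \<Rightarrow> L t y p) (case z of (t, y, p) \<Rightarrow> L t y p) < \<epsilon>"
      using \<epsilon>(1) unfolding uniformly_continuous_on_def by metis
    define \<delta> where "\<delta> = min 1 (\<delta>' / 2)"
    have "0 < \<delta>" using \<open>0 < \<delta>'\<close> by (simp add: \<delta>_def)
    have close: "\<bar>L t y q - L t0 y0 q\<bar> < \<epsilon>"
      if t: "t \<in> {a..b}" "\<bar>t - t0\<bar> < \<delta>" and y: "dist y0 y < \<delta>" and q: "norm q \<le> M + 1" for t y q
    proof -
      have "dist (t, y, q) (t0, y0, q) = sqrt ((dist t t0)\<^sup>2 + (dist y y0)\<^sup>2)"
        by (simp add: dist_Pair_Pair)
      also have "\<dots> \<le> dist t t0 + dist y y0"
        by (rule sqrt_sum_squares_le_sum) auto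
      also have "\<dots> < \<delta>'"
        using t(2) y by (simp add: \<delta>_def dist_real_def dist_commute)
      finally show ?thesis
        using \<delta>'[of "(t0, y0, q)" "(t, y, q)"] t t0 y q by (simp add: \<delta>_def dist_real_def)
    qed
    show "\<exists>\<delta>>0. \<forall>p. norm p = M \<longrightarrow> (\<exists>\<xi>. \<forall>t\<in>{a..b}. \<forall>y. \<bar>t - t0\<bar> < \<delta> \<longrightarrow> dist y0 y < \<delta> \<longrightarrow>
      L t y p \<le> L t0 y0 p + \<epsilon> \<and>
      (\<forall>q. L t0 y0 p - \<epsilon> + \<xi> \<bullet> (q - p) + (if 1 \<le> norm (q - p) then \<tau> else 0) \<le> L t y q))"
    proof (intro exI[of _ \<delta>] conjI allI impI \<open>0 < \<delta>\<close>)
      fix p :: "real ^ 'n" assume p: "norm p = M"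
      have "Max {\<bar>t0\<bar>, norm y0, norm p} \<le> R + 1" using R p by simp
      then obtain \<xi> where sub: "\<And>q. L t0 y0 p + \<xi> \<bullet> (q - p) \<le> L t0 y0 q"
        and strict: "\<And>q. inverse R \<le> norm (q - p) \<Longrightarrow> L t0 y0 p + \<xi> \<bullet> (q - p) + 2 * \<tau> \<le> L t0 y0 q"
        using \<tau> t0 unfolding is_subgradient_def by blast
      have "inverse R \<le> 1" using R(1) by (simp add: inverse_le_1_iff)
      show "\<exists>\<xi>. \<forall>t\<in>{a..b}. \<forall>y. \<bar>t - t0\<bar> < \<delta> \<longrightarrow> dist y0 y < \<delta> \<longrightarrow>
          L t y p \<le> L t0 y0 p + \<epsilon> \<and>
          (\<forall>q. L t0 y0 p - \<epsilon> + \<xi> \<bullet> (q - p) + (if 1 \<le> norm (q - p) then \<tau> else 0) \<le> L t y q)"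
      proof (intro exI[of _ \<xi>] ballI allI impI)
        fix t y assume t: "t \<in> {a..b}" "\<bar>t - t0\<bar> < \<delta>" and y: "dist y0 y < \<delta>"
        note close = close[OF t y]
        have Lp: "\<bar>L t y p - L t0 y0 p\<bar> < \<epsilon>" using p by (intro close) simp
        have "L t0 y0 p - \<epsilon> + \<xi> \<bullet> (q - p) + (if 1 \<le> norm (q - p) then \<tau> else 0) \<le> L t y q" for q
        proof (cases "1 \<le> norm (q - p)")
          case False
          then have "norm q \<le> M + 1"
            using norm_triangle_ineq[of p "q - p"] p by simp
          from close[OF this] sub[of q] False show ?thesis by simp
        next
          case True
          define s where "s = norm (q - p)"
          \<comment> \<open>the point where the segment from \<open>p\<close> to \<open>q\<close> leaves the unit ball around \<open>p\<close>\<close>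
          define q' where "q' = p + (1 / s) *\<^sub>R (q - p)"
          have "1 \<le> s" using True by (simp add: s_def)
          have "norm (q - p) = s" by (simp add: s_def)
          with \<open>1 \<le> s\<close> have q'p: "norm (q' - p) = 1" by (simp add: q'_def)
          have "\<xi> \<bullet> (q' - p) = \<xi> \<bullet> (q - p) / s" by (simp add: q'_def)
          from q'p have "norm q' \<le> M + 1"
            using norm_triangle_ineq[of p "q' - p"] p by simp
          with close[of q'] have Lq': "L t0 y0 p + (\<xi> \<bullet> (q - p)) / s + 2 * \<tau> - \<epsilon> \<le> L t y q'"
            using strict[of q'] \<open>inverse R \<le> 1\<close> q'p \<open>\<xi> \<bullet> (q' - p) = \<xi> \<bullet> (q - p) / s\<close> by simp
          obtain \<zeta> where \<zeta>: "\<And>x. L t y q' + \<zeta> \<bullet> (x - q') \<le> L t y x"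
            using SC_subgradient[OF SC t(1), of y q'] unfolding is_subgradient_def by blast
          have "q - q' = (1 - 1 / s) *\<^sub>R (q - p)" "p - q' = - ((1 / s) *\<^sub>R (q - p))"
            by (simp_all add: q'_def scaleR_diff_left)
          then have "L t y q' + (1 - 1 / s) * (\<zeta> \<bullet> (q - p)) \<le> L t y q"
            "L t y q' - (1 / s) * (\<zeta> \<bullet> (q - p)) \<le> L t y p"
            using \<zeta>[of q] \<zeta>[of p] by simp_all
          \<comment> \<open>weighted so that the terms with \<open>\<zeta>\<close> cancel; this is convexity of \<open>L t y\<close> at \<open>q'\<close>, multiplied by \<open>s\<close>\<close>
          then have "1 * (L t y q' + (1 - 1 / s) * (\<zeta> \<bullet> (q - p))) + (s - 1) * (L t y q' - (1 / s) * (\<zeta> \<bullet> (q - p)))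
              \<le> 1 * L t y q + (s - 1) * L t y p"
            using \<open>1 \<le> s\<close> by (intro add_mono mult_left_mono) auto
          also have "1 * (L t y q' + (1 - 1 / s) * (\<zeta> \<bullet> (q - p))) + (s - 1) * (L t y q' - (1 / s) * (\<zeta> \<bullet> (q - p)))
              = s * L t y q'"
            using \<open>1 \<le> s\<close> by (simp add: field_simps)
          finally have "L t y p + s * (L t y q' - L t y p) \<le> L t y q"
            by (simp add: algebra_simps)
          moreover have "s * ((\<xi> \<bullet> (q - p)) / s + (2 * \<tau> - 2 * \<epsilon>)) \<le> s * (L t y q' - L t y p)"
            using Lq' Lp \<open>1 \<le> s\<close> by (intro mult_left_mono) auto
          moreover have "\<xi> \<bullet> (q - p) + 1 * (2 * \<tau> - 2 * \<epsilon>) \<le> s * ((\<xi> \<bullet> (q - p)) / s + (2 * \<tau> - 2 * \<epsilon>))"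
            using \<open>1 \<le> s\<close> \<epsilon> mult_right_mono[of 1 s "2 * \<tau> - 2 * \<epsilon>"] by (simp add: distrib_left)
          ultimately show ?thesis
            using Lp \<epsilon> True by (simp add: abs_less_iff)
        qed
        with Lp show "L t y p \<le> L t0 y0 p + \<epsilon> \<and>
            (\<forall>q. L t0 y0 p - \<epsilon> + \<xi> \<bullet> (q - p) + (if 1 \<le> norm (q - p) then \<tau> else 0) \<le> L t y q)"
          by (simp add: abs_less_iff)
      qed
    qed
  qed
qed

lemma chord_in_ball:
  fixes v :: "real \<Rightarrow> 'b::real_normed_vector"
  assumes "v x \<in> ball z \<delta>" "v y \<in> ball z \<delta>" "x < y" "r \<in> {x..y}"
  shows "chord v x y r \<in> ball z \<delta>"
proof -
  define u where "u = (r - x) / (y - x)"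
  have "0 \<le> u" "u \<le> 1" using assms(3,4) by (auto simp: u_def)
  then have "(1 - u) *\<^sub>R v x + u *\<^sub>R v y \<in> ball z \<delta>"
    by (rule convexD_alt[OF convex_ball assms(1,2)])
  moreover have "(1 - u) *\<^sub>R v x + u *\<^sub>R v y = chord v x y r"
    by (simp add: chord_def slope_def u_def algebra_simps divide_inverse)
  ultimately show ?thesis by simp
qed

text \<open>A chord whose slope has norm \<open>m + 1\<close> differs by at least 1 from every velocity of norm at most \<open>m\<close>, so on the
slow set the strict part of the supporting inequality is gained.\<close>

lemma slow_set_sparse:
  fixes v g :: "real \<Rightarrow> real ^ 'n"
  assumes "a < b" and L: "continuous_on ({a..b} \<times> UNIV \<times> UNIV) (\<lambda>(t, y, p). L t y p)"
    and SC: "strict_convexity_SC a b L" and min: "is_minimizer L a b v" and prim: "primitive_on a b v g"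
    and t0: "t0 \<in> {a..b}" and "0 < m" "0 < c"
  shows "\<exists>\<delta>>0. \<forall>x y. a \<le> x \<and> x < y \<and> y \<le> b \<and> \<bar>x - t0\<bar> < \<delta> \<and> \<bar>y - t0\<bar> < \<delta> \<and>
    norm (v y - v x) = (m + 1) * (y - x) \<longrightarrow>
    measure lebesgue {r \<in> {x<..<y}. norm (g r) \<le> m} \<le> c * (y - x)"
proof -
  define y0 where "y0 = v t0"
  obtain \<tau> where "0 < \<tau>" and \<tau>: "\<And>\<epsilon>. 0 < \<epsilon> \<Longrightarrow> \<epsilon> \<le> \<tau> / 2 \<Longrightarrow>
    \<exists>\<delta>>0. \<forall>p. norm p = m + 1 \<longrightarrow> (\<exists>\<xi>. \<forall>t\<in>{a..b}. \<forall>y. \<bar>t - t0\<bar> < \<delta> \<longrightarrow> dist y0 y < \<delta> \<longrightarrow>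
      L t y p \<le> L t0 y0 p + \<epsilon> \<and>
      (\<forall>q. L t0 y0 p - \<epsilon> + \<xi> \<bullet> (q - p) + (if 1 \<le> norm (q - p) then \<tau> else 0) \<le> L t y q))"
    using uniform_strict_support[OF L SC t0, of "m + 1" y0] by blast
  \<comment> \<open>the second bound turns \<open>\<tau> * \<bar>slow set\<bar> \<le> 2 * \<epsilon> * (y - x)\<close> into the claim\<close>
  define \<epsilon> where "\<epsilon> = min (\<tau> / 2) (c * \<tau> / 2)"
  have "0 < \<epsilon>" "\<epsilon> \<le> \<tau> / 2" "2 * \<epsilon> \<le> c * \<tau>"
    using \<open>0 < \<tau>\<close> \<open>0 < c\<close> by (auto simp: \<epsilon>_def)
  obtain \<delta>1 where "0 < \<delta>1" and \<delta>1: "\<And>p. norm p = m + 1 \<Longrightarrow>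
      \<exists>\<xi>. \<forall>t\<in>{a..b}. \<forall>y. \<bar>t - t0\<bar> < \<delta>1 \<longrightarrow> dist y0 y < \<delta>1 \<longrightarrow> L t y p \<le> L t0 y0 p + \<epsilon> \<and>
      (\<forall>q. L t0 y0 p - \<epsilon> + \<xi> \<bullet> (q - p) + (if 1 \<le> norm (q - p) then \<tau> else 0) \<le> L t y q)"
    using \<tau>[OF \<open>0 < \<epsilon>\<close> \<open>\<epsilon> \<le> \<tau> / 2\<close>] by blast
  obtain \<delta>2 where "0 < \<delta>2" and \<delta>2: "\<And>r. r \<in> {a..b} \<Longrightarrow> \<bar>r - t0\<bar> < \<delta>2 \<Longrightarrow> dist y0 (v r) < \<delta>1"
    using primitive_on_continuous[OF prim] t0 \<open>0 < \<delta>1\<close>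
    unfolding continuous_on_iff y0_def dist_real_def by (metis dist_commute)
  show ?thesis
  proof (intro exI[of _ "min \<delta>1 \<delta>2"] conjI allI impI; (elim conjE)?)
    show "0 < min \<delta>1 \<delta>2" using \<open>0 < \<delta>1\<close> \<open>0 < \<delta>2\<close> by simp
    fix x y assume xy: "a \<le> x" "x < y" "y \<le> b" and near: "\<bar>x - t0\<bar> < min \<delta>1 \<delta>2" "\<bar>y - t0\<bar> < min \<delta>1 \<delta>2"
      and speed: "norm (v y - v x) = (m + 1) * (y - x)"
    define p where "p = slope v x y"
    define A where "A = {r \<in> {x<..<y}. norm (g r) \<le> m}"
    have p: "norm p = m + 1" "v y - v x = (y - x) *\<^sub>R p"
      using xy(2) speed by (simp_all add: p_def slope_def)
    obtain \<xi> where \<xi>: "\<And>t y. t \<in> {a..b} \<Longrightarrow> \<bar>t - t0\<bar> < \<delta>1 \<Longrightarrow> dist y0 y < \<delta>1 \<Longrightarrow> L t y p \<le> L t0 y0 p + \<epsilon>"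
      "\<And>t y q. t \<in> {a..b} \<Longrightarrow> \<bar>t - t0\<bar> < \<delta>1 \<Longrightarrow> dist y0 y < \<delta>1 \<Longrightarrow>
        L t0 y0 p - \<epsilon> + \<xi> \<bullet> (q - p) + (if 1 \<le> norm (q - p) then \<tau> else 0) \<le> L t y q"
      using \<delta>1[OF p(1)] by metis
    have r_near: "r \<in> {a..b}" "\<bar>r - t0\<bar> < \<delta>1" "dist y0 (v r) < \<delta>1" if "r \<in> {x..y}" for r
      using that xy near by (auto intro!: \<delta>2)
    have G: "(\<lambda>r. norm (g r)) absolutely_integrable_on {x..y}"
      using absolutely_integrable_norm[OF primitive_on_integrable[OF prim, of x y]] xy by (simp add: o_def)
    have A_meas: "A \<in> lmeasurable"
      unfolding A_def by (rule lmeasurable_sublevel[OF G]) auto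
    have "(g has_integral (y - x) *\<^sub>R p) {x..y}"
      using primitive_onD[OF prim, of x y] xy p(2) by simp
    from has_integral_linear[OF this bounded_linear_inner_right[of \<xi>]]
    have "((\<lambda>r. \<xi> \<bullet> g r) has_integral \<xi> \<bullet> ((y - x) *\<^sub>R p)) {x..y}"
      by (simp only: o_def)
    moreover have "((\<lambda>r. \<tau> * indicator A r) has_integral \<tau> * measure lebesgue A) {x..y}"
      by (rule has_integral_mult_indicator[OF A_meas]) (auto simp: A_def)
    moreover have "((\<lambda>r. L t0 y0 p - \<epsilon> - \<xi> \<bullet> p) has_integral (y - x) * (L t0 y0 p - \<epsilon> - \<xi> \<bullet> p)) {x..y}"
      using has_integral_const_real[of "L t0 y0 p - \<epsilon> - \<xi> \<bullet> p" x y] xy by simp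
    ultimately have lower: "((\<lambda>r. L t0 y0 p - \<epsilon> - \<xi> \<bullet> p + \<xi> \<bullet> g r + \<tau> * indicator A r) has_integral
        (y - x) * (L t0 y0 p - \<epsilon> - \<xi> \<bullet> p) + \<xi> \<bullet> ((y - x) *\<^sub>R p) + \<tau> * measure lebesgue A) {x..y}"
      by (intro has_integral_add)
    have "(y - x) * (L t0 y0 p - \<epsilon> - \<xi> \<bullet> p) + \<xi> \<bullet> ((y - x) *\<^sub>R p) + \<tau> * measure lebesgue A
        \<le> integral {x..y} (\<lambda>r. L r (v r) (g r))"
    proof (rule has_integral_le[OF lower])
      show "((\<lambda>r. L r (v r) (g r)) has_integral integral {x..y} (\<lambda>r. L r (v r) (g r))) {x..y}"
        by (rule integrable_integral[OF minimizer_beats_chord(1)[OF \<open>a < b\<close> L SC min prim xy]])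
      fix r assume r: "r \<in> {x..y}"
      have "1 \<le> norm (g r - p)" if "r \<in> A"
        using norm_triangle_ineq2[of p "g r"] that p(1) by (simp add: A_def norm_minus_commute)
      then show "L t0 y0 p - \<epsilon> - \<xi> \<bullet> p + \<xi> \<bullet> g r + \<tau> * indicator A r \<le> L r (v r) (g r)"
        using \<xi>(2)[OF r_near[OF r], of "g r"] \<open>0 < \<tau>\<close>
        by (auto simp: inner_diff_right indicator_def split: if_splits)
    qed
    also have "\<dots> \<le> integral {x..y} (\<lambda>r. L r (chord v x y r) p)"
      unfolding p_def by (rule minimizer_beats_chord(2)[OF \<open>a < b\<close> L SC min prim xy])
    also have "\<dots> \<le> (y - x) * (L t0 y0 p + \<epsilon>)"
    proof (rule has_integral_le[OF integrable_integral])
      show "(\<lambda>r. L r (chord v x y r) p) integrable_on {x..y}"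
        unfolding p_def by (rule integrable_continuous_real[OF continuous_on_Lagrangian_chord[OF L xy(1,3)]])
      show "((\<lambda>_. L t0 y0 p + \<epsilon>) has_integral (y - x) * (L t0 y0 p + \<epsilon>)) {x..y}"
        using has_integral_const_real[of "L t0 y0 p + \<epsilon>" x y] xy by simp
      fix r assume r: "r \<in> {x..y}"
      have "chord v x y r \<in> ball y0 \<delta>1"
        by (rule chord_in_ball) (use r_near[of x] r_near[of y] xy r in auto)
      then show "L r (chord v x y r) p \<le> L t0 y0 p + \<epsilon>"
        by (intro \<xi>(1) r_near[OF r]) simp
    qed
    finally have "\<tau> * measure lebesgue A \<le> (2 * \<epsilon>) * (y - x)"
      by (simp add: algebra_simps)
    also have "\<dots> \<le> (c * \<tau>) * (y - x)"
      using \<open>2 * \<epsilon> \<le> c * \<tau>\<close> xy by (intro mult_right_mono) auto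
    finally have "\<tau> * measure lebesgue A \<le> \<tau> * (c * (y - x))" by (simp add: mult_ac)
    then show "measure lebesgue {r \<in> {x<..<y}. norm (g r) \<le> m} \<le> c * (y - x)"
      using \<open>0 < \<tau>\<close> by (simp add: A_def)
  qed
qed

section \<open>Infinite one-sided derivatives\<close>

lemma infinite_derivative_steep:
  assumes "has_extended_derivative v t D F" "\<bar>D $ i\<bar> = \<infinity>" "F \<le> at t"
  shows "\<forall>\<^sub>F s in F. M * \<bar>s - t\<bar> < norm (v s - v t)"
proof -
  have lim: "((\<lambda>s. ereal ((v s $ i - v t $ i) / (s - t))) \<longlongrightarrow> D $ i) F"
    using assms(1) by (simp add: has_extended_derivative_def)
  have "\<forall>\<^sub>F s in F. M < \<bar>(v s $ i - v t $ i) / (s - t)\<bar>"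
  proof (cases "D $ i = \<infinity>")
    case True
    with lim have "\<forall>\<^sub>F s in F. ereal M < ereal ((v s $ i - v t $ i) / (s - t))"
      by (simp add: tendsto_PInfty)
    then show ?thesis
      by eventually_elim (rule order_less_le_trans[OF _ abs_ge_self], simp)
  next
    case False
    with assms(2) have "D $ i = - \<infinity>" by (cases "D $ i") auto
    with lim have "\<forall>\<^sub>F s in F. ereal ((v s $ i - v t $ i) / (s - t)) < ereal (- M)"
      by (simp add: tendsto_MInfty)
    then show ?thesis
      by eventually_elim (rule order_less_le_trans[OF _ abs_ge_minus_self], simp)
  qed
  moreover have "\<forall>\<^sub>F s in F. s \<noteq> t"
    using assms(3) by (rule filter_leD) (simp add: eventually_at_filter)
  ultimately show ?thesis
  proof eventually_elim
    case (elim s)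
    then have "M * \<bar>s - t\<bar> < \<bar>(v s - v t) $ i\<bar>" by (simp add: abs_divide less_divide_eq)
    also have "\<dots> \<le> norm (v s - v t)" by (rule component_le_norm_cart)
    finally show ?case .
  qed
qed

lemma primitive_on_speed:
  assumes prim: "primitive_on a b u g" and xy: "a \<le> x" "x \<le> y" "y \<le> b"
  shows "norm (u y - u x) \<le> integral {x..y} (\<lambda>r. norm (g r))"
proof -
  have "g absolutely_integrable_on {x..y}"
    by (rule primitive_on_integrable[OF prim]) (use xy in auto)
  then have "norm (integral {x..y} g) \<le> integral {x..y} (\<lambda>r. norm (g r))"
    unfolding absolutely_integrable_on_def by (intro integral_norm_bound_integral) auto
  then show ?thesis
    using integral_unique[OF primitive_onD[OF prim xy]] by simp
qed

lemma slow_set_density_right: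
  fixes v g :: "real \<Rightarrow> real ^ 'n"
  assumes "a < b" and L: "continuous_on ({a..b} \<times> UNIV \<times> UNIV) (\<lambda>(t, y, p). L t y p)"
    and SC: "strict_convexity_SC a b L" and min: "is_minimizer L a b v" and prim: "primitive_on a b v g"
    and t: "a \<le> t" "t < b" and "0 < m"
    and steep: "\<forall>\<^sub>F s in at_right t. (m + 1) * \<bar>s - t\<bar> < norm (v s - v t)"
  shows "((\<lambda>s. inverse (s - t) * measure lebesgue {r \<in> {t<..<s}. norm (g r) \<le> m}) \<longlongrightarrow> 0) (at_right t)"
proof (rule tendstoI)
  fix e :: real assume "0 < e"
  \<comment> \<open>the covering doubles the density \<open>e / 4\<close>, and \<open>e / 2\<close> is strictly below \<open>e\<close>\<close>
  have "t \<in> {a..b}" "0 < e / 4" using t \<open>0 < e\<close> by simp_all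
  from slow_set_sparse[OF \<open>a < b\<close> L SC min prim this(1) \<open>0 < m\<close> this(2)]
  obtain \<delta> where "0 < \<delta>" and \<delta>: "\<forall>x y. a \<le> x \<and> x < y \<and> y \<le> b \<and> \<bar>x - t\<bar> < \<delta> \<and> \<bar>y - t\<bar> < \<delta> \<and>
    norm (v y - v x) = (m + 1) * (y - x) \<longrightarrow>
    measure lebesgue {r \<in> {x<..<y}. norm (g r) \<le> m} \<le> e / 4 * (y - x)"
    by blast
  obtain z where "t < z" and z: "\<And>s. t < s \<Longrightarrow> s < z \<Longrightarrow> (m + 1) * \<bar>s - t\<bar> < norm (v s - v t)"
    using steep unfolding eventually_at_right_field by blast
  define q where "q = min (t + \<delta>) (min z b)"
  have "t < q" using \<open>0 < \<delta>\<close> \<open>t < z\<close> t by (simp add: q_def)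
  have bound: "measure lebesgue {r \<in> {t<..<s}. norm (g r) \<le> m} \<le> 2 * (e / 4) * (s - t)" if s: "t < s" "s < q" for s
  proof (rule sublevel_measure_bound[where w = v and M = "m + 1"])
    have sub: "{t..s} \<subseteq> {a..b}" using s t by (auto simp: q_def)
    show "continuous_on {t..s} v"
      by (rule continuous_on_subset[OF primitive_on_continuous[OF prim] sub])
    show "(\<lambda>r. norm (g r)) absolutely_integrable_on {t..s}"
      using absolutely_integrable_norm[OF primitive_on_integrable[OF prim sub]] by (simp add: o_def)
    show "norm (v y - v x) \<le> integral {x..y} (\<lambda>r. norm (g r))" if "t \<le> x" "x \<le> y" "y \<le> s" for x y
      by (rule primitive_on_speed[OF prim]) (use that s t in \<open>auto simp: q_def\<close>)
    show "(m + 1) * (x - t) < norm (v x - v t)" if "t < x" "x \<le> s" for x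
      using z[of x] that s by (simp add: q_def)
    show "measure lebesgue {r \<in> {y<..<x}. norm (g r) \<le> m} \<le> e / 4 * (x - y)"
      if "t < y" "y < x" "x \<le> s" "norm (v x - v y) = (m + 1) * (x - y)" for y x
      by (rule \<delta>[rule_format]) (use that s t in \<open>auto simp: q_def\<close>)
  qed (use s \<open>0 < e\<close> in auto)
  have "dist (inverse (s - t) * measure lebesgue {r \<in> {t<..<s}. norm (g r) \<le> m}) 0 < e"
    if s: "t < s" "s < q" for s
  proof -
    have "inverse (s - t) * measure lebesgue {r \<in> {t<..<s}. norm (g r) \<le> m} \<le> inverse (s - t) * (2 * (e / 4) * (s - t))"
      using s by (intro mult_left_mono bound) auto
    also have "\<dots> = e / 2" using s by simp
    also have "\<dots> < e" using \<open>0 < e\<close> by simp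
    finally show ?thesis using s by (simp add: abs_mult)
  qed
  then show "\<forall>\<^sub>F s in at_right t. dist (inverse (s - t) * measure lebesgue {r \<in> {t<..<s}. norm (g r) \<le> m}) 0 < e"
    unfolding eventually_at_right_field using \<open>t < q\<close> by blast
qed

lemma slow_set_density_left:
  fixes v g :: "real \<Rightarrow> real ^ 'n"
  assumes "a < b" and L: "continuous_on ({a..b} \<times> UNIV \<times> UNIV) (\<lambda>(t, y, p). L t y p)"
    and SC: "strict_convexity_SC a b L" and min: "is_minimizer L a b v" and prim: "primitive_on a b v g"
    and t: "a < t" "t \<le> b" and "0 < m"
    and steep: "\<forall>\<^sub>F s in at_left t. (m + 1) * \<bar>s - t\<bar> < norm (v s - v t)"
  shows "((\<lambda>s. inverse (t - s) * measure lebesgue {r \<in> {s<..<t}. norm (g r) \<le> m}) \<longlongrightarrow> 0) (at_left t)"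
proof (rule tendstoI)
  fix e :: real assume "0 < e"
  \<comment> \<open>the covering doubles the density \<open>e / 4\<close>, and \<open>e / 2\<close> is strictly below \<open>e\<close>\<close>
  have "t \<in> {a..b}" "0 < e / 4" using t \<open>0 < e\<close> by simp_all
  from slow_set_sparse[OF \<open>a < b\<close> L SC min prim this(1) \<open>0 < m\<close> this(2)]
  obtain \<delta> where "0 < \<delta>" and \<delta>: "\<forall>x y. a \<le> x \<and> x < y \<and> y \<le> b \<and> \<bar>x - t\<bar> < \<delta> \<and> \<bar>y - t\<bar> < \<delta> \<and>
    norm (v y - v x) = (m + 1) * (y - x) \<longrightarrow>
    measure lebesgue {r \<in> {x<..<y}. norm (g r) \<le> m} \<le> e / 4 * (y - x)"
    by blast
  obtain z where "z < t" and z: "\<And>s. z < s \<Longrightarrow> s < t \<Longrightarrow> (m + 1) * \<bar>s - t\<bar> < norm (v s - v t)"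
    using steep unfolding eventually_at_left_field by blast
  define q where "q = max (t - \<delta>) (max z a)"
  have "q < t" using \<open>0 < \<delta>\<close> \<open>z < t\<close> t by (simp add: q_def)
  have bound: "measure lebesgue {r \<in> {s<..<t}. norm (g r) \<le> m} \<le> 2 * (e / 4) * (t - s)" if s: "q < s" "s < t" for s
  proof (rule sublevel_measure_bound_left[where w = v and M = "m + 1"])
    have sub: "{s..t} \<subseteq> {a..b}" using s t by (auto simp: q_def)
    show "continuous_on {s..t} v"
      by (rule continuous_on_subset[OF primitive_on_continuous[OF prim] sub])
    show "(\<lambda>r. norm (g r)) absolutely_integrable_on {s..t}"
      using absolutely_integrable_norm[OF primitive_on_integrable[OF prim sub]] by (simp add: o_def)
    show "norm (v y - v x) \<le> integral {x..y} (\<lambda>r. norm (g r))" if "s \<le> x" "x \<le> y" "y \<le> t" for x y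
      by (rule primitive_on_speed[OF prim]) (use that s t in \<open>auto simp: q_def\<close>)
    show "(m + 1) * (t - x) < norm (v x - v t)" if "s \<le> x" "x < t" for x
      using z[of x] that s by (simp add: q_def)
    show "measure lebesgue {r \<in> {y<..<x}. norm (g r) \<le> m} \<le> e / 4 * (x - y)"
      if "s \<le> y" "y < x" "x < t" "norm (v x - v y) = (m + 1) * (x - y)" for y x
      by (rule \<delta>[rule_format]) (use that s t in \<open>auto simp: q_def\<close>)
  qed (use s \<open>0 < e\<close> in auto)
  have "dist (inverse (t - s) * measure lebesgue {r \<in> {s<..<t}. norm (g r) \<le> m}) 0 < e"
    if s: "q < s" "s < t" for s
  proof -
    have "inverse (t - s) * measure lebesgue {r \<in> {s<..<t}. norm (g r) \<le> m} \<le> inverse (t - s) * (2 * (e / 4) * (t - s))"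
      using s by (intro mult_left_mono bound) auto
    also have "\<dots> = e / 2" using s by simp
    also have "\<dots> < e" using \<open>0 < e\<close> by simp
    finally show ?thesis using s by (simp add: abs_mult)
  qed
  then show "\<forall>\<^sub>F s in at_left t. dist (inverse (t - s) * measure lebesgue {r \<in> {s<..<t}. norm (g r) \<le> m}) 0 < e"
    unfolding eventually_at_left_field using \<open>q < t\<close> by blast
qed

theorem theorem25:
  fixes a b t :: real
    and L :: "real \<Rightarrow> real ^ 'n \<Rightarrow> real ^ 'n \<Rightarrow> real"
    and v :: "real \<Rightarrow> real ^ 'n"
  assumes "a < b"
    and "continuous_on ({a..b} \<times> UNIV \<times> UNIV) (\<lambda>(t, y, p). L t y p)"
    and "strict_convexity_SC a b L"
    and "v \<in> W11 a b"
    and "is_minimizer L a b v"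
    and "t \<in> {a..b}"
  shows "(t \<in> {a<..b} \<and>
            (\<exists>D. has_extended_derivative v t D (at_left t) \<and> (\<exists>i. \<bar>D $ i\<bar> = \<infinity>)) \<longrightarrow>
          (\<forall>m>0. ((\<lambda>s. inverse (t - s) *
                     measure lebesgue {r \<in> {s<..<t}. norm (weak_deriv a b v r) \<le> m})
                   \<longlongrightarrow> 0) (at_left t))) \<and>
         (t \<in> {a..<b} \<and>
            (\<exists>D. has_extended_derivative v t D (at_right t) \<and> (\<exists>i. \<bar>D $ i\<bar> = \<infinity>)) \<longrightarrow>
          (\<forall>m>0. ((\<lambda>s. inverse (s - t) *
                     measure lebesgue {r \<in> {t<..<s}. norm (weak_deriv a b v r) \<le> m})
                   \<longlongrightarrow> 0) (at_right t)))"
proof (intro conjI impI allI)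
  note prim = W11_primitive_on[OF assms(1,4)]
  fix m :: real assume "0 < m"
  show "((\<lambda>s. inverse (t - s) * measure lebesgue {r \<in> {s<..<t}. norm (weak_deriv a b v r) \<le> m}) \<longlongrightarrow> 0) (at_left t)"
    if left: "t \<in> {a<..b} \<and> (\<exists>D. has_extended_derivative v t D (at_left t) \<and> (\<exists>i. \<bar>D $ i\<bar> = \<infinity>))"
  proof (rule slow_set_density_left[OF assms(1-3,5) prim])
    from left obtain D i where D: "has_extended_derivative v t D (at_left t)" "\<bar>D $ i\<bar> = \<infinity>"
      by (elim conjE exE)
    show "\<forall>\<^sub>F s in at_left t. (m + 1) * \<bar>s - t\<bar> < norm (v s - v t)"
      by (rule infinite_derivative_steep[OF D at_le[OF subset_UNIV]])
  qed (use left \<open>0 < m\<close> in auto)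
  show "((\<lambda>s. inverse (s - t) * measure lebesgue {r \<in> {t<..<s}. norm (weak_deriv a b v r) \<le> m}) \<longlongrightarrow> 0) (at_right t)"
    if right: "t \<in> {a..<b} \<and> (\<exists>D. has_extended_derivative v t D (at_right t) \<and> (\<exists>i. \<bar>D $ i\<bar> = \<infinity>))"
  proof (rule slow_set_density_right[OF assms(1-3,5) prim])
    from right obtain D i where D: "has_extended_derivative v t D (at_right t)" "\<bar>D $ i\<bar> = \<infinity>"
      by (elim conjE exE)
    show "\<forall>\<^sub>F s in at_right t. (m + 1) * \<bar>s - t\<bar> < norm (v s - v t)"
      by (rule infinite_derivative_steep[OF D at_le[OF subset_UNIV]])
  qed (use right \<open>0 < m\<close> in auto)
qed

end
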